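(* Let $n\ge 3$, let $c$ be a Coxeter element of $\mathfrak S_n$ given by a fixed word in which each of $s_1,\dots,s_{n-1}$ appears exactly once, and let $\pi\in\mathfrak S_n$. The following are equivalent: (i) $\pi$ is $c$-sortable; (ii) the $c$-sorting word $\pi(c)$ is accepted by the automaton $\mathbb P(U_c,D_c)$; (iii) there exists a reduced word for $\pi$ accepted by $\mathbb P(U_c,D_c)$; (iv) for each $j\in[2,n-1]$ there exists a reduced word for $\pi$ accepted by $\mathbb U(j)$ if $j\in U_c$ and by $\mathbb D(j)$ if $j\in D_c$; (v) $\pi$ avoids $jki$ for every $j\in U_c$ and $kij$ for every $j\in D_c$ (with $i<j<k$).
   Context: $\mathfrak S_n$ is generated by $s_a=(a\ a{+}1)$; a word $s_{a_1}\cdots s_{a_\ell}$ represents $s_{a_1}\circ\cdots\circ s_{a_\ell}$ (one-line notation $\pi(1)\cdots\pi(n)$), reduced if $\ell$ is minimal. For fixed $j$, $\pi$ avoids $jki$ (resp. $kij$) if there are no $i<j<k$ with $j,k,i$ (resp. $k,i,j$) appearing in this order in $\pi(1)\cdots\pi(n)$. $U_c$ (resp. $D_c$) is the set of $j\in[2,n-1]$ such that $s_j$ appears before (resp. after) $s_{j-1}$ in $c$. The $c$-sorting word $\pi(c)$ is the subword of $c^\infty=c\,c\,c\cdots$ which is a reduced word for $\pi$ and whose set of positions is lexicographically first; writing $L_r$ for the set of letters of $\pi(c)$ taken from the $r$-th copy of $c$, $\pi$ is $c$-sortable if $L_1\supseteq L_2\supseteq\cdots$. Automata read words left to right over $\{s_1,\dots,s_{n-1}\}$;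 unspecified transitions are loops; a word is accepted iff its run never enters a dead state (dead states absorbing and rejecting, all others accepting). $\mathbb U(j)$: states $H_j$ (initial), $H_{j+1},\dots,H_n$, ill states $I_j,\dots,I_{n-1}$, dead; for $m\in[j,n-1]$: $H_m\xrightarrow{s_m}H_{m+1}$, $H_m\xrightarrow{s_{m-1}}I_m$, $I_m\xrightarrow{s_m}$ dead; $H_n$ loops on all letters. $\mathbb D(j)$: states $G_j$ (initial), $G_{j-1},\dots,G_1$, ill states $J_j,\dots,J_2$, dead; for $m\in[2,j]$: $G_m\xrightarrow{s_{m-1}}G_{m-1}$, $G_m\xrightarrow{s_m}J_m$, $J_m\xrightarrow{s_{m-1}}$ dead; $G_1$ loops on all letters. $\mathbb P(U,D)$ is the product automaton of all $\mathbb U(j)$, $j\in U$, and $\mathbb D(j)$, $j\in D$: it accepts a word iff each of these automata accepts it. *)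

theory Defs
  imports "HOL-Combinatorics.Permutations"
begin

text \<open>
  The simple transposition \<open>s\<^sub>a = (a a+1)\<close> is encoded by the letter \<open>a\<close>, and a permutation of
  \<open>{1..n}\<close> by a function \<open>\<pi> :: nat \<Rightarrow> nat\<close> with \<open>\<pi> permutes {1..n}\<close>.
\<close>

definition word_perm :: "nat list \<Rightarrow> nat \<Rightarrow> nat" where
  "word_perm w = foldr (\<lambda>a f. transpose a (Suc a) \<circ> f) w id"

definition word_for :: "nat \<Rightarrow> (nat \<Rightarrow> nat) \<Rightarrow> nat list \<Rightarrow> bool" where
  "word_for n \<pi> w \<longleftrightarrow> set w \<subseteq> {1..n-1} \<and> word_perm w = \<pi>"

definition reduced_word_for :: "nat \<Rightarrow> (nat \<Rightarrow> nat) \<Rightarrow> nat list \<Rightarrow> bool" where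
  "reduced_word_for n \<pi> w \<longleftrightarrow>
     word_for n \<pi> w \<and> (\<forall>v. word_for n \<pi> v \<longrightarrow> length w \<le> length v)"

definition coxeter_word :: "nat \<Rightarrow> nat list \<Rightarrow> bool" where
  "coxeter_word n c \<longleftrightarrow> distinct c \<and> set c = {1..n-1}"

definition appears_before :: "'a list \<Rightarrow> 'a \<Rightarrow> 'a \<Rightarrow> bool" where
  "appears_before c a b \<longleftrightarrow> (\<exists>p q. p < q \<and> q < length c \<and> c ! p = a \<and> c ! q = b)"

definition up_set :: "nat \<Rightarrow> nat list \<Rightarrow> nat set" where
  "up_set n c = {j \<in> {2..n-1}. appears_before c j (j-1)}"

definition down_set :: "nat \<Rightarrow> nat list \<Rightarrow> nat set" where
  "down_set n c = {j \<in> {2..n-1}. appears_before c (j-1) j}"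


subsection \<open>Pattern avoidance\<close>

definition in_order :: "nat \<Rightarrow> (nat \<Rightarrow> nat) \<Rightarrow> nat \<Rightarrow> nat \<Rightarrow> nat \<Rightarrow> bool" where
  "in_order n \<pi> x y z \<longleftrightarrow>
     (\<exists>p q r. 1 \<le> p \<and> p < q \<and> q < r \<and> r \<le> n \<and> \<pi> p = x \<and> \<pi> q = y \<and> \<pi> r = z)"

definition avoids_jki :: "nat \<Rightarrow> (nat \<Rightarrow> nat) \<Rightarrow> nat \<Rightarrow> bool" where
  "avoids_jki n \<pi> j \<longleftrightarrow> \<not> (\<exists>i k. i < j \<and> j < k \<and> in_order n \<pi> j k i)"

definition avoids_kij :: "nat \<Rightarrow> (nat \<Rightarrow> nat) \<Rightarrow> nat \<Rightarrow> bool" where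
  "avoids_kij n \<pi> j \<longleftrightarrow> \<not> (\<exists>i k. i < j \<and> j < k \<and> in_order n \<pi> k i j)"


subsection \<open>Sorting words and sortability\<close>

definition cyclic_word :: "'a list \<Rightarrow> nat \<Rightarrow> 'a" where
  "cyclic_word c i = c ! (i mod length c)"

definition subword_at :: "'a list \<Rightarrow> nat set \<Rightarrow> 'a list" where
  "subword_at c P = map (cyclic_word c) (sorted_list_of_set P)"

definition reduced_positions :: "nat \<Rightarrow> nat list \<Rightarrow> (nat \<Rightarrow> nat) \<Rightarrow> nat set \<Rightarrow> bool" where
  "reduced_positions n c \<pi> P \<longleftrightarrow> finite P \<and> reduced_word_for n \<pi> (subword_at c P)"

text \<open>
  Position sets are compared through their increasing enumerations. All candidates have the
  same cardinality (the length of \<open>\<pi>\<close>), so the case of a proper prefix in \<^const>\<open>lexord\<close> never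
  arises, and for a Coxeter word \<open>c\<close> and \<open>\<pi> permutes {1..n}\<close> there is a unique first one.
\<close>

definition sorting_positions :: "nat \<Rightarrow> nat list \<Rightarrow> (nat \<Rightarrow> nat) \<Rightarrow> nat set" where
  "sorting_positions n c \<pi> = (THE P. reduced_positions n c \<pi> P \<and>
     (\<forall>Q. reduced_positions n c \<pi> Q \<longrightarrow> Q \<noteq> P \<longrightarrow>
        (sorted_list_of_set P, sorted_list_of_set Q) \<in> lexord {(x, y). x < y}))"

definition sorting_word :: "nat \<Rightarrow> nat list \<Rightarrow> (nat \<Rightarrow> nat) \<Rightarrow> nat list" where
  "sorting_word n c \<pi> = subword_at c (sorting_positions n c \<pi>)"

text \<open>Copies of \<open>c\<close> are numbered from \<open>0\<close>.\<close>

definition copy_letters :: "nat \<Rightarrow> nat list \<Rightarrow> (nat \<Rightarrow> nat) \<Rightarrow> nat \<Rightarrow> nat set" where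
  "copy_letters n c \<pi> r =
     cyclic_word c ` {i \<in> sorting_positions n c \<pi>. i div length c = r}"

definition sortable :: "nat \<Rightarrow> nat list \<Rightarrow> (nat \<Rightarrow> nat) \<Rightarrow> bool" where
  "sortable n c \<pi> \<longleftrightarrow> (\<forall>r. copy_letters n c \<pi> (Suc r) \<subseteq> copy_letters n c \<pi> r)"


subsection \<open>Automata\<close>

record ('q, 'a) automaton =
  states :: "'q set"
  initial :: 'q
  trans_fun :: "'q \<Rightarrow> 'a \<Rightarrow> 'q"
  dead_states :: "'q set"

definition run_state :: "('q, 'a) automaton \<Rightarrow> 'a list \<Rightarrow> 'q" where
  "run_state A w = foldl (trans_fun A) (initial A) w"

definition accepts :: "('q, 'a) automaton \<Rightarrow> 'a list \<Rightarrow> bool" where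
  "accepts A w \<longleftrightarrow> (\<forall>k \<le> length w. run_state A (take k w) \<notin> dead_states A)"

definition product_automaton ::
    "'i set \<Rightarrow> ('i \<Rightarrow> ('q, 'a) automaton) \<Rightarrow> ('i \<Rightarrow> 'q, 'a) automaton" where
  "product_automaton K A =
     \<lparr>states = (\<Pi>\<^sub>E k\<in>K. states (A k)),
      initial = (\<lambda>k\<in>K. initial (A k)),
      trans_fun = (\<lambda>q a. \<lambda>k\<in>K. trans_fun (A k) (q k) a),
      dead_states = {q \<in> (\<Pi>\<^sub>E k\<in>K. states (A k)). \<exists>k\<in>K. q k \<in> dead_states (A k)}\<rparr>"

datatype state = H nat | I nat | G nat | J nat | Dead

fun U_step :: "nat \<Rightarrow> nat \<Rightarrow> state \<Rightarrow> nat \<Rightarrow> state" where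
  "U_step n j (H m) a =
     (if m \<in> {j..n-1} \<and> a = m then H (m+1)
      else if m \<in> {j..n-1} \<and> a = m-1 then I m
      else H m)"
| "U_step n j (I m) a = (if m \<in> {j..n-1} \<and> a = m then Dead else I m)"
| "U_step n j q a = q"

definition U_automaton :: "nat \<Rightarrow> nat \<Rightarrow> (state, nat) automaton" where
  "U_automaton n j =
     \<lparr>states = H ` {j..n} \<union> I ` {j..n-1} \<union> {Dead},
      initial = H j,
      trans_fun = U_step n j,
      dead_states = {Dead}\<rparr>"

fun D_step :: "nat \<Rightarrow> state \<Rightarrow> nat \<Rightarrow> state" where
  "D_step j (G m) a =
     (if m \<in> {2..j} \<and> a = m-1 then G (m-1)
      else if m \<in> {2..j} \<and> a = m then J m
      else G m)"
| "D_step j (J m) a = (if m \<in> {2..j} \<and> a = m-1 then Dead else J m)"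
| "D_step j q a = q"

definition D_automaton :: "nat \<Rightarrow> (state, nat) automaton" where
  "D_automaton j =
     \<lparr>states = G ` {1..j} \<union> J ` {2..j} \<union> {Dead},
      initial = G j,
      trans_fun = D_step j,
      dead_states = {Dead}\<rparr>"

definition P_automaton :: "nat \<Rightarrow> nat set \<Rightarrow> nat set \<Rightarrow> (nat + nat \<Rightarrow> state, nat) automaton" where
  "P_automaton n U D = product_automaton (U <+> D) (case_sum (U_automaton n) D_automaton)"

end

theory Submission
  imports Defs
begin

text \<open>
  Let \<open>f = inv \<pi>\<close>, viewed as the sequence \<open>f 1, \<dots>, f n\<close>. Reading \<open>c\<^sup>\<infinity>\<close> and swapping the
  entries at \<open>a, a+1\<close> whenever the current letter is \<open>a\<close> and they form a descent sorts \<open>f\<close>;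
  the letters at which a swap occurs form the \<open>c\<close>-sorting word. Hence \<open>\<pi>\<close> is
  \<open>c\<close>-sortable iff a letter that is skipped once is never used again. Rotating \<open>c\<close> past its
  first letter keeps both this property and the pattern condition, which proves that they
  are equivalent.

  Whether a reduced word for \<open>\<pi>\<close> is accepted depends on the word. An accepting run, however,
  certifies that its final permutation avoids the pattern: while \<open>U_automaton n j\<close> is in state \<open>H\<^sub>m\<close> or
  \<open>I\<^sub>m\<close>, all values right of position \<open>m\<close> exceed \<open>j\<close>, and all values larger than \<open>j\<close> in the
  first \<open>m\<close> positions stand left of \<open>j\<close>. Conversely, when \<open>U_automaton n j\<close> falls ill in state \<open>I\<^sub>m\<close>
  while reading a sorting word, the letter \<open>m\<close> has just been skipped, so for a sortable
  permutation it does not occur again and the run survives.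
\<close>

subsection \<open>Words and inversions\<close>

lemma word_perm_Nil [simp]: "word_perm [] = id"
  by (simp add: word_perm_def)

lemma word_perm_Cons: "word_perm (a # w) = transpose a (Suc a) \<circ> word_perm w"
  by (simp add: word_perm_def)

lemma word_perm_append: "word_perm (u @ v) = word_perm u \<circ> word_perm v"
  by (induction u) (simp_all add: word_perm_Cons comp_assoc)

lemma word_perm_snoc: "word_perm (w @ [a]) = word_perm w \<circ> transpose a (Suc a)"
  by (simp add: word_perm_append word_perm_Cons)

lemma word_perm_permutes:
  assumes "set w \<subseteq> {1..n-1}"
  shows "word_perm w permutes {1..n}"
  using assms
proof (induction w)
  case Nil
  show "word_perm [] permutes {1..n}" by simp
next
  case (Cons a w)
  then have "transpose a (Suc a) permutes {1..n}"
    by (intro permutes_swap_id) auto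
  moreover have "word_perm w permutes {1..n}" using Cons by simp
  ultimately show "word_perm (a # w) permutes {1..n}"
    unfolding word_perm_Cons by (intro permutes_compose)
qed

lemma word_perm_rev_comp: "word_perm (rev w) \<circ> word_perm w = id"
proof (induction w)
  case (Cons a w)
  have "word_perm (rev (a # w)) \<circ> word_perm (a # w)
      = word_perm (rev w) \<circ> (transpose a (Suc a) \<circ> transpose a (Suc a)) \<circ> word_perm w"
    by (simp only: rev.simps word_perm_snoc word_perm_Cons comp_assoc)
  with Cons show ?case by simp
qed simp

text \<open>Inversions are pairs of positions, so a swap of adjacent positions acts on them
  directly. For a permutation their number is the Coxeter length, see
  \<open>reduced_word_for_iff\<close>.\<close>

definition inversions :: "nat \<Rightarrow> (nat \<Rightarrow> nat) \<Rightarrow> (nat \<times> nat) set" where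
  "inversions n f = {(x, y). 1 \<le> x \<and> x < y \<and> y \<le> n \<and> f y < f x}"

lemma finite_inversions [simp]: "finite (inversions n f)"
  by (rule finite_subset[of _ "{1..n} \<times> {1..n}"]) (auto simp: inversions_def)

text \<open>The swap, applied to both coordinates, keeps the order of every pair of positions except
  \<open>(a, Suc a)\<close>, which is an inversion only before the swap.\<close>

lemma card_inversions_descent:
  assumes "1 \<le> a" "a < n" "f (Suc a) < f a"
  shows "Suc (card (inversions n (f \<circ> transpose a (Suc a)))) = card (inversions n f)"
proof -
  let ?t = "transpose a (Suc a)"
  have "bij_betw (map_prod ?t ?t) (inversions n (f \<circ> ?t)) (inversions n f - {(a, Suc a)})"
  proof (rule bij_betw_byWitness[where f' = "map_prod ?t ?t"])
    show "map_prod ?t ?t ` inversions n (f \<circ> ?t) \<subseteq> inversions n f - {(a, Suc a)}"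
      using assms by (auto simp: inversions_def transpose_def split: if_splits)
    show "map_prod ?t ?t ` (inversions n f - {(a, Suc a)}) \<subseteq> inversions n (f \<circ> ?t)"
      using assms by (auto simp: inversions_def transpose_def split: if_splits)
  qed auto
  then have "card (inversions n (f \<circ> ?t)) = card (inversions n f - {(a, Suc a)})"
    by (rule bij_betw_same_card)
  moreover have "(a, Suc a) \<in> inversions n f"
    using assms by (simp add: inversions_def)
  ultimately show ?thesis
    by (metis card_Suc_Diff1 finite_inversions)
qed

lemma card_inversions_ascent:
  assumes "1 \<le> a" "a < n" "f a < f (Suc a)"
  shows "card (inversions n (f \<circ> transpose a (Suc a))) = Suc (card (inversions n f))"
  using card_inversions_descent[of a n "f \<circ> transpose a (Suc a)"] assms
  by (simp add: comp_assoc)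

lemma card_inversions_transpose_le:
  assumes "1 \<le> a" "a < n"
  shows "card (inversions n (f \<circ> transpose a (Suc a))) \<le> Suc (card (inversions n f))"
proof -
  consider "f (Suc a) < f a" | "f a < f (Suc a)" | "f a = f (Suc a)"
    by linarith
  then show ?thesis
  proof cases
    case 3
    then have "f \<circ> transpose a (Suc a) = f"
      by (auto simp: fun_eq_iff transpose_def)
    then show ?thesis by simp
  qed (use assms card_inversions_descent[of a n f] card_inversions_ascent[of a n f] in auto)
qed

lemma card_inversions_comp_word_perm_le:
  assumes "set w \<subseteq> {1..n-1}"
  shows "card (inversions n (f \<circ> word_perm w)) \<le> card (inversions n f) + length w"
  using assms
proof (induction w rule: rev_induct)
  case (snoc a w)
  then have "1 \<le> a" "a < n" by auto
  with snoc card_inversions_transpose_le[of a n "f \<circ> word_perm w"] show ?case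
    by (simp add: word_perm_snoc o_def)
qed simp

lemma inversions_id [simp]: "inversions n id = {}"
  by (auto simp: inversions_def)

lemma card_inversions_word_perm_le:
  assumes "set w \<subseteq> {1..n-1}"
  shows "card (inversions n (word_perm w)) \<le> length w"
  using card_inversions_comp_word_perm_le[OF assms, of id] by simp

text \<open>An inversion of \<open>inv \<pi>\<close> is a pair of values in the wrong order; the
  positions of these values form an inversion of \<open>\<pi>\<close>, and conversely.\<close>

lemma card_inversions_inv:
  assumes "\<pi> permutes {1..n}"
  shows "card (inversions n (inv \<pi>)) = card (inversions n \<pi>)"
proof -
  let ?f = "\<lambda>(x, y). (inv \<pi> y, inv \<pi> x)" and ?g = "\<lambda>(p, q). (\<pi> q, \<pi> p)"
  have rng: "\<pi> x \<in> {1..n} \<longleftrightarrow> x \<in> {1..n}" "inv \<pi> x \<in> {1..n} \<longleftrightarrow> x \<in> {1..n}" for x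
    using assms permutes_inv[OF assms] by (meson permutes_in_image)+
  have "bij_betw ?f (inversions n (inv \<pi>)) (inversions n \<pi>)"
  proof (rule bij_betw_byWitness[where f' = ?g])
    show "?f ` inversions n (inv \<pi>) \<subseteq> inversions n \<pi>"
      using rng(2) by (fastforce simp: inversions_def permutes_inverses[OF assms])
    show "?g ` inversions n \<pi> \<subseteq> inversions n (inv \<pi>)"
      using rng(1) by (fastforce simp: inversions_def permutes_inverses[OF assms])
  qed (auto simp: permutes_inverses[OF assms])
  then show ?thesis by (rule bij_betw_same_card)
qed

subsection \<open>The sorting word as a bubble sort\<close>

text \<open>Letters come from an infinite sequence \<open>s\<close>, so dropping the first letter,
  which rotates the Coxeter word, is a mere shift of \<open>s\<close>.\<close>

primrec bubble :: "(nat \<Rightarrow> nat) \<Rightarrow> (nat \<Rightarrow> nat) \<Rightarrow> nat \<Rightarrow> nat \<Rightarrow> nat" where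
  "bubble s f 0 = f"
| "bubble s f (Suc i) =
     (if bubble s f i (Suc (s i)) < bubble s f i (s i)
      then bubble s f i \<circ> transpose (s i) (Suc (s i)) else bubble s f i)"

definition swaps :: "(nat \<Rightarrow> nat) \<Rightarrow> (nat \<Rightarrow> nat) \<Rightarrow> nat set" where
  "swaps s f = {i. bubble s f i (Suc (s i)) < bubble s f i (s i)}"

lemma bubble_Suc_shift: "bubble s f (Suc i) = bubble (\<lambda>j. s (Suc j)) (bubble s f 1) i"
  by (induction i) auto

lemma Suc_in_swaps: "Suc i \<in> swaps s f \<longleftrightarrow> i \<in> swaps (\<lambda>j. s (Suc j)) (bubble s f 1)"
  unfolding swaps_def mem_Collect_eq bubble_Suc_shift ..

lemma sorted_list_of_set_append:
  fixes A B :: "nat set"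
  assumes "finite A" "finite B" "\<And>x y. x \<in> A \<Longrightarrow> y \<in> B \<Longrightarrow> x < y"
  shows "sorted_list_of_set (A \<union> B) = sorted_list_of_set A @ sorted_list_of_set B"
proof (rule sorted_distinct_set_unique)
  show "sorted (sorted_list_of_set A @ sorted_list_of_set B)"
    using assms by (auto simp: sorted_append less_imp_le)
  show "distinct (sorted_list_of_set A @ sorted_list_of_set B)"
    using assms by fastforce
qed (use assms in auto)

lemma subword_at_append:
  assumes "finite A" "finite B" "\<And>x y. x \<in> A \<Longrightarrow> y \<in> B \<Longrightarrow> x < y"
  shows "subword_at c (A \<union> B) = subword_at c A @ subword_at c B"
  by (simp add: subword_at_def sorted_list_of_set_append[OF assms])

lemma length_subword_at [simp]: "length (subword_at c P) = card P"
  by (simp add: subword_at_def)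

lemma subword_at_lessThan_Suc:
  "subword_at c (P \<inter> {..<Suc i}) =
     subword_at c (P \<inter> {..<i}) @ (if i \<in> P then [cyclic_word c i] else [])"
proof (cases "i \<in> P")
  case True
  then have "P \<inter> {..<Suc i} = (P \<inter> {..<i}) \<union> {i}"
    by (auto simp: less_Suc_eq)
  with True show ?thesis
    by (simp only:) (subst subword_at_append, auto simp: subword_at_def)
next
  case False
  then have "P \<inter> {..<Suc i} = P \<inter> {..<i}"
    by (auto simp: less_Suc_eq)
  with False show ?thesis by simp
qed

lemma bubble_eq_comp:
  "bubble (cyclic_word c) f i = f \<circ> word_perm (subword_at c (swaps (cyclic_word c) f \<inter> {..<i}))"
proof (induction i)
  case 0
  show ?case by (simp add: subword_at_def)
next
  case (Suc i)
  then show ?case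
    unfolding subword_at_lessThan_Suc
    by (simp add: swaps_def word_perm_snoc o_def)
qed

text \<open>Each swap happens at a descent and removes exactly one inversion: swaps made and
  inversions left balance at all times.\<close>

lemma card_inversions_bubble:
  assumes "\<And>i. 1 \<le> s i" "\<And>i. s i < n"
  shows "card (swaps s f \<inter> {..<i}) + card (inversions n (bubble s f i)) = card (inversions n f)"
proof (induction i)
  case (Suc i)
  show ?case
  proof (cases "i \<in> swaps s f")
    case True
    then have "swaps s f \<inter> {..<Suc i} = insert i (swaps s f \<inter> {..<i})"
      by (auto simp: less_Suc_eq)
    then have "card (swaps s f \<inter> {..<Suc i}) = Suc (card (swaps s f \<inter> {..<i}))"
      by simp
    with Suc True card_inversions_descent[OF assms, of "bubble s f i" i] show ?thesis
      by (simp add: swaps_def o_def)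
  next
    case False
    then have "swaps s f \<inter> {..<Suc i} = swaps s f \<inter> {..<i}"
      by (auto simp: less_Suc_eq)
    with False Suc show ?thesis by (simp add: swaps_def)
  qed
qed simp

text \<open>The balance bounds the swaps in every prefix by the initial number of inversions, so no
  larger finite set of swaps exists.\<close>

lemma finite_swaps:
  assumes "\<And>i. 1 \<le> s i" "\<And>i. s i < n"
  shows "finite (swaps s f)"
proof (rule ccontr)
  assume "infinite (swaps s f)"
  then obtain A where A: "A \<subseteq> swaps s f" "finite A" "card A = Suc (card (inversions n f))"
    by (meson infinite_arbitrarily_large)
  obtain i where "\<forall>x\<in>A. x < i"
    using A(2) unfolding finite_nat_set_iff_bounded ..
  with A have "card A \<le> card (swaps s f \<inter> {..<i})"
    by (intro card_mono) auto
  with A card_inversions_bubble[of s n f i] assms show False by simp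
qed

section \<open>Termination of the bubble sort in the identity\<close>

lemma strict_mono_on_atLeastAtMostI:
  fixes g :: "nat \<Rightarrow> 'a::linorder"
  assumes "\<And>a. 1 \<le> a \<Longrightarrow> a < n \<Longrightarrow> g a < g (Suc a)"
  shows "strict_mono_on {1..n} g"
proof (rule strict_mono_onI)
  fix x y assume "x \<in> {1..n}" "y \<in> {1..n}" "x < y"
  then have "Suc x \<le> y" "1 \<le> x" "y \<le> n" by auto
  then show "g x < g y"
  proof (induction y rule: dec_induct)
    case base
    then show ?case using assms by simp
  next
    case (step y)
    then show ?case using assms[of y] by (simp add: less_trans)
  qed
qed

lemma permutes_strict_mono_on_eq_id:
  fixes g :: "nat \<Rightarrow> nat"
  assumes g: "g permutes {1..n}" and mono: "strict_mono_on {1..n} g"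
  shows "g = id"
proof -
  have "x \<le> g x" if "x \<in> {1..n}" for x
  proof -
    have "1 \<le> x" "x \<le> n" using that by auto
    then show ?thesis
    proof (induction x rule: dec_induct)
      case base
      then show ?case using permutes_in_image[OF g, of 1] by auto
    next
      case (step y)
      then show ?case using strict_mono_onD[OF mono, of y "Suc y"] by simp
    qed
  qed
  moreover have "g x \<le> x" if "x \<in> {1..n}" for x
  proof -
    have "x \<le> n" "1 \<le> x" using that by auto
    then show ?thesis
    proof (induction x rule: inc_induct)
      case base
      then show ?case using permutes_in_image[OF g, of n] by auto
    next
      case (step y)
      then show ?case using strict_mono_onD[OF mono, of y "Suc y"] by simp
    qed
  qed
  ultimately show ?thesis
    using g by (metis eq_id_iff le_antisym permutes_not_in)
qed

lemma coxeter_word_nonempty: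
  "coxeter_word n c \<Longrightarrow> 2 \<le> n \<Longrightarrow> c \<noteq> []"
  by (auto simp: coxeter_word_def)

lemma cyclic_word_bounds:
  assumes "coxeter_word n c" "2 \<le> n"
  shows "1 \<le> cyclic_word c i" "cyclic_word c i < n"
proof -
  have "cyclic_word c i \<in> set c"
    using coxeter_word_nonempty[OF assms] by (simp add: cyclic_word_def)
  with assms show "1 \<le> cyclic_word c i" "cyclic_word c i < n"
    by (auto simp: coxeter_word_def)
qed

lemma cyclic_word_add_length [simp]: "cyclic_word c (i + length c) = cyclic_word c i"
  by (simp add: cyclic_word_def)

lemma cyclic_word_eq_iff:
  assumes "coxeter_word n c" "2 \<le> n"
  shows "cyclic_word c i = cyclic_word c k \<longleftrightarrow> i mod length c = k mod length c"
  using assms coxeter_word_nonempty[OF assms]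
  by (auto simp: cyclic_word_def coxeter_word_def nth_eq_iff_index_eq)

lemma cyclic_word_surj:
  assumes "coxeter_word n c" "1 \<le> a" "a < n"
  obtains i where "N \<le> i" "cyclic_word c i = a"
proof -
  have "a \<in> set c" using assms by (auto simp: coxeter_word_def)
  then obtain k where k: "k < length c" "c ! k = a" by (auto simp: in_set_conv_nth)
  then have "N \<le> k + length c * N"
    by (metis One_nat_def Suc_leI less_zeroE mult_le_mono1 mult_1 neq0_conv trans_le_add2)
  moreover have "cyclic_word c (k + length c * N) = a"
    using k by (simp add: cyclic_word_def)
  ultimately show ?thesis using that by blast
qed

lemma inj_bubble: "inj f \<Longrightarrow> inj (bubble s f i)"
  by (induction i) (auto intro: inj_compose)

text \<open>Once the last swap is made the sequence stays fixed, yet every letter is still to come;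
  a remaining descent would be swapped. Injectivity excludes ties.\<close>

lemma bubble_eventually_sorted:
  assumes c: "coxeter_word n c" "2 \<le> n" and f: "inj f"
  obtains N where "swaps (cyclic_word c) f \<subseteq> {..<N}"
    and "strict_mono_on {1..n} (bubble (cyclic_word c) f N)"
proof -
  let ?s = "cyclic_word c"
  have "finite (swaps ?s f)" using finite_swaps[OF cyclic_word_bounds[OF c]] .
  then obtain N where "\<forall>i\<in>swaps ?s f. i < N" unfolding finite_nat_set_iff_bounded ..
  then have N: "swaps ?s f \<subseteq> {..<N}" by auto
  have stable: "bubble ?s f i = bubble ?s f N" if "N \<le> i" for i
    using that
  proof (induction i rule: dec_induct)
    case (step i)
    then have "i \<notin> swaps ?s f" using N by auto
    with step show ?case by (simp add: swaps_def)
  qed simp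
  have "bubble ?s f N a < bubble ?s f N (Suc a)" if a: "1 \<le> a" "a < n" for a
  proof -
    obtain i where i: "N \<le> i" "?s i = a" using cyclic_word_surj[OF c(1) a] .
    then have "i \<notin> swaps ?s f" using N by auto
    with i stable[OF i(1)] have "\<not> bubble ?s f N (Suc a) < bubble ?s f N a"
      by (simp add: swaps_def)
    moreover have "bubble ?s f N (Suc a) \<noteq> bubble ?s f N a"
      using inj_bubble[OF f, of ?s N] by (simp add: inj_eq)
    ultimately show ?thesis by simp
  qed
  with N show ?thesis using that strict_mono_on_atLeastAtMostI by blast
qed

lemma set_subword_at:
  assumes "coxeter_word n c" "2 \<le> n"
  shows "set (subword_at c P) \<subseteq> {1..n-1}"
proof -
  have "cyclic_word c i \<in> {1..n-1}" for i
    using cyclic_word_bounds[OF assms, of i] by auto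
  then show ?thesis by (auto simp: subword_at_def)
qed

text \<open>The final sequence is \<open>inv \<pi>\<close> times the word read at the swaps. Being
  an increasing permutation it is the identity, so that word represents \<open>\<pi>\<close>; with
  no inversions left, the balance gives its length.\<close>

lemma swaps_word:
  assumes c: "coxeter_word n c" "2 \<le> n" and \<pi>: "\<pi> permutes {1..n}"
  defines "T \<equiv> swaps (cyclic_word c) (inv \<pi>)"
  shows "word_for n \<pi> (subword_at c T)" "card T = card (inversions n \<pi>)"
proof -
  let ?s = "cyclic_word c"
  note inv_perm = permutes_inv[OF \<pi>]
  obtain N where N: "T \<subseteq> {..<N}" "strict_mono_on {1..n} (bubble ?s (inv \<pi>) N)"
    using bubble_eventually_sorted[OF c permutes_inj[OF inv_perm]] unfolding T_def .
  then have TN: "T \<inter> {..<N} = T" by auto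
  have eq: "bubble ?s (inv \<pi>) N = inv \<pi> \<circ> word_perm (subword_at c T)"
    using bubble_eq_comp[of c "inv \<pi>" N] TN by (simp add: T_def)
  have "bubble ?s (inv \<pi>) N permutes {1..n}"
    unfolding eq
    by (rule permutes_compose[OF word_perm_permutes[OF set_subword_at[OF c]] inv_perm])
  then have id: "bubble ?s (inv \<pi>) N = id"
    using N(2) by (rule permutes_strict_mono_on_eq_id)
  have "word_perm (subword_at c T) = \<pi> \<circ> (inv \<pi> \<circ> word_perm (subword_at c T))"
    by (simp add: permutes_inv_o[OF \<pi>] flip: comp_assoc)
  also have "\<dots> = \<pi>" using eq id by simp
  finally show "word_for n \<pi> (subword_at c T)"
    using set_subword_at[OF c] by (simp add: word_for_def)
  show "card T = card (inversions n \<pi>)"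
    using card_inversions_bubble[of ?s n "inv \<pi>" N, OF cyclic_word_bounds[OF c]] TN id
    by (simp add: T_def[symmetric] card_inversions_inv[OF \<pi>])
qed

section \<open>Reduced words and lexicographic minimality of the swaps\<close>

lemma card_inversions_le_length:
  "word_for n \<pi> v \<Longrightarrow> card (inversions n \<pi>) \<le> length v"
  using card_inversions_word_perm_le by (auto simp: word_for_def)

text \<open>Inversions bound the length of every word from below, and the word read at the swaps for
  \<open>c\<close> attains the bound; \<open>c\<close> enters as the source of this witness.\<close>

lemma reduced_word_for_iff:
  assumes "coxeter_word n c" "2 \<le> n" "\<pi> permutes {1..n}"
  shows "reduced_word_for n \<pi> w \<longleftrightarrow> word_for n \<pi> w \<and> length w = card (inversions n \<pi>)"
  using swaps_word[OF assms] card_inversions_le_length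
  by (auto simp: reduced_word_for_def) (metis le_antisym length_subword_at)

lemma reduced_positions_swaps:
  assumes "coxeter_word n c" "2 \<le> n" "\<pi> permutes {1..n}"
  shows "reduced_positions n c \<pi> (swaps (cyclic_word c) (inv \<pi>))"
  using swaps_word[OF assms] finite_swaps[OF cyclic_word_bounds[OF assms(1,2)]]
  by (simp add: reduced_positions_def reduced_word_for_iff[OF assms])

text \<open>Compare the sets at the first position \<open>m\<close> where they differ. If
  \<open>m\<close> is a swap, \<open>Q\<close> continues with a later position and so comes after.
  If \<open>m\<close> belongs to \<open>Q\<close>, that set spends a letter on an ascent and has too
  few letters left to finish sorting.\<close>

lemma swaps_lexord_least:
  assumes c: "coxeter_word n c" "2 \<le> n" and \<pi>: "\<pi> permutes {1..n}"
  defines "T \<equiv> swaps (cyclic_word c) (inv \<pi>)"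
  assumes Q: "reduced_positions n c \<pi> Q" and "Q \<noteq> T"
  shows "(sorted_list_of_set T, sorted_list_of_set Q) \<in> lexord {(x, y). x < y}"
proof -
  let ?s = "cyclic_word c" and ?l = "sorted_list_of_set :: nat set \<Rightarrow> nat list"
  have finT: "finite T" and cardT: "card T = card (inversions n \<pi>)"
    using reduced_positions_swaps[OF c \<pi>] swaps_word(2)[OF c \<pi>]
    by (auto simp: T_def reduced_positions_def)
  have finQ: "finite Q" and cardQ: "card Q = card T" and wQ: "word_perm (subword_at c Q) = \<pi>"
    using Q cardT by (auto simp: reduced_positions_def reduced_word_for_iff[OF c \<pi>] word_for_def)
  define m where "m = (LEAST i. i \<in> T \<longleftrightarrow> i \<notin> Q)"
  have "\<exists>i. i \<in> T \<longleftrightarrow> i \<notin> Q" using \<open>Q \<noteq> T\<close> by blast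
  then have m: "m \<in> T \<longleftrightarrow> m \<notin> Q" unfolding m_def by (rule LeastI_ex)
  define A where "A = T \<inter> {..<m}"
  have AQ: "A = Q \<inter> {..<m}" using not_less_Least by (fastforce simp: m_def A_def)
  have finA: "finite A" using finT by (simp add: A_def)
  have lT: "?l (A \<union> B) = ?l A @ ?l B" if "finite B" "B \<subseteq> {m..}" for B
    by (rule sorted_list_of_set_append) (use that finA in \<open>auto simp: A_def\<close>)
  have lm: "?l ({m} \<union> B) = m # ?l B" if "finite B" "B \<subseteq> {m<..}" for B
    using sorted_list_of_set_append[of "{m}" B] that by auto
  show ?thesis
  proof (cases "m \<in> T")
    case True
    define B where "B = Q \<inter> {m..}"
    have QB: "Q = A \<union> B" by (auto simp: AQ B_def)
    have "B \<noteq> {}"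
    proof
      assume "B = {}"
      then have "Q \<subset> T" using QB m True by (auto simp: A_def)
      then have "card Q < card T" by (rule psubset_card_mono[OF finT])
      with cardQ show False by simp
    qed
    moreover have finB: "finite B" using finQ by (simp add: B_def)
    ultimately obtain b bs where b: "?l B = b # bs"
      by (metis neq_Nil_conv sorted_list_of_set_eq_Nil_iff)
    then have "b \<in> B" using finB by (metis list.set_intros(1) set_sorted_list_of_set)
    then have "m < b" using m True by (auto simp: B_def le_less)
    moreover have "?l T = ?l A @ m # ?l (T \<inter> {m<..})"
    proof -
      have "T = A \<union> ({m} \<union> (T \<inter> {m<..}))" using True by (auto simp: A_def)
      then have "?l T = ?l (A \<union> ({m} \<union> (T \<inter> {m<..})))" by (rule arg_cong)
      also have "\<dots> = ?l A @ ?l ({m} \<union> (T \<inter> {m<..}))" by (rule lT) (use finT in auto)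
      also have "?l ({m} \<union> (T \<inter> {m<..})) = m # ?l (T \<inter> {m<..})" by (rule lm) (use finT in auto)
      finally show ?thesis .
    qed
    moreover have "?l Q = ?l A @ b # bs"
    proof -
      have "?l Q = ?l (A \<union> B)" using QB by (rule arg_cong)
      also have "\<dots> = ?l A @ ?l B" by (rule lT) (use finB in \<open>auto simp: B_def\<close>)
      finally show ?thesis unfolding b .
    qed
    ultimately show ?thesis
      by (simp add: lexord_append_left_rightI)
  next
    case False
    define V where "V = Q \<inter> {m<..}"
    let ?a = "?s m" and ?v = "subword_at c V" and ?g = "bubble ?s (inv \<pi>) m"
    have QV: "Q = A \<union> ({m} \<union> V)"
      using m False by (auto simp: AQ V_def)
    have finV: "finite V" using finQ by (simp add: V_def)
    have "?l Q = ?l (A \<union> ({m} \<union> V))" using QV by (rule arg_cong)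
    also have "\<dots> = ?l A @ ?l ({m} \<union> V)" by (rule lT) (use finV in \<open>auto simp: V_def\<close>)
    also have "?l ({m} \<union> V) = m # ?l V" by (rule lm) (use finV in \<open>auto simp: V_def\<close>)
    finally have sub: "subword_at c Q = subword_at c A @ ?a # ?v"
      by (simp add: subword_at_def)
    have g: "?g = inv \<pi> \<circ> word_perm (subword_at c A)"
      unfolding A_def T_def by (rule bubble_eq_comp)
    \<comment> \<open>Since \<open>Q\<close> represents \<open>\<pi>\<close>, its letters after
      \<open>m\<close> must undo the sequence obtained from \<open>?g\<close> by the swap at
      \<open>m\<close>; that sequence is therefore the permutation of these letters
      reversed.\<close>
    have "(?g \<circ> transpose ?a (Suc ?a)) \<circ> word_perm ?v = inv \<pi> \<circ> word_perm (subword_at c Q)"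
      by (simp add: g sub word_perm_append word_perm_Cons comp_assoc)
    also have "\<dots> = id" using permutes_inv_o[OF \<pi>] by (simp add: wQ)
    finally have "(?g \<circ> transpose ?a (Suc ?a)) \<circ> (word_perm ?v \<circ> word_perm (rev ?v)) = word_perm (rev ?v)"
      by (simp flip: comp_assoc)
    then have rev: "?g \<circ> transpose ?a (Suc ?a) = word_perm (rev ?v)"
      using word_perm_rev_comp[of "rev ?v"] by simp
    have "inj ?g" by (intro inj_bubble permutes_inj[OF permutes_inv[OF \<pi>]])
    then have "?g (Suc ?a) \<noteq> ?g ?a" by (simp add: inj_eq)
    with False have "?g ?a < ?g (Suc ?a)" by (simp add: T_def swaps_def)
    then have "Suc (card (inversions n ?g)) = card (inversions n (word_perm (rev ?v)))"
      using card_inversions_ascent[OF cyclic_word_bounds[OF c]] unfolding rev[symmetric] by metis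
    also have "\<dots> \<le> card V"
      using card_inversions_word_perm_le[of "rev ?v" n] set_subword_at[OF c, of V] by simp
    also have "\<dots> < card T - card A"
    proof -
      have "card Q = length (subword_at c Q)" by simp
      also have "\<dots> = card A + Suc (card V)" unfolding sub by simp
      finally show ?thesis using cardQ by simp
    qed
    \<comment> \<open>The balance gives \<open>?g\<close> exactly \<open>card T - card A\<close>
      inversions, so this chain is contradictory and the case cannot occur.\<close>
    finally show ?thesis
      using card_inversions_bubble[of ?s n "inv \<pi>" m, OF cyclic_word_bounds[OF c]] cardT
      by (simp add: A_def T_def card_inversions_inv[OF \<pi>])
  qed
qed

lemma sorting_positions_eq_swaps:
  assumes c: "coxeter_word n c" "2 \<le> n" and \<pi>: "\<pi> permutes {1..n}"
  shows "sorting_positions n c \<pi> = swaps (cyclic_word c) (inv \<pi>)"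
  unfolding sorting_positions_def
proof (rule the_equality)
  let ?T = "swaps (cyclic_word c) (inv \<pi>)"
  show T: "reduced_positions n c \<pi> ?T \<and> (\<forall>Q. reduced_positions n c \<pi> Q \<longrightarrow> Q \<noteq> ?T \<longrightarrow>
      (sorted_list_of_set ?T, sorted_list_of_set Q) \<in> lexord {(x, y). x < y})"
    using reduced_positions_swaps[OF assms] swaps_lexord_least[OF assms] by blast
  fix P
  assume P: "reduced_positions n c \<pi> P \<and> (\<forall>Q. reduced_positions n c \<pi> Q \<longrightarrow> Q \<noteq> P \<longrightarrow>
      (sorted_list_of_set P, sorted_list_of_set Q) \<in> lexord {(x, y). x < y})"
  \<comment> \<open>Two distinct sets that are both first would precede each other, against
    asymmetry of the lexicographic order.\<close>
  have "asym {(x, y :: nat). x < y}" by (auto intro: asymI)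
  then show "P = ?T" using P T lexord_asymmetric by metis
qed

lemma reduced_word_for_sorting_word:
  assumes "coxeter_word n c" "2 \<le> n" "\<pi> permutes {1..n}"
  shows "reduced_word_for n \<pi> (sorting_word n c \<pi>)"
  using reduced_positions_swaps[OF assms]
  by (simp add: sorting_word_def sorting_positions_eq_swaps[OF assms] reduced_positions_def)

text \<open>A Coxeter word has each letter once, so copy number and letter determine the position;
  inclusion of consecutive copies is thus a shift of positions by \<open>length c\<close>.\<close>

lemma sortable_iff_nested:
  assumes c: "coxeter_word n c" "2 \<le> n" and \<pi>: "\<pi> permutes {1..n}"
  defines "T \<equiv> swaps (cyclic_word c) (inv \<pi>)"
  shows "sortable n c \<pi> \<longleftrightarrow> (\<forall>i. i + length c \<in> T \<longrightarrow> i \<in> T)"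
proof -
  have len: "length c > 0" using coxeter_word_nonempty[OF c] by simp
  have eq: "copy_letters n c \<pi> r = cyclic_word c ` {i \<in> T. i div length c = r}" for r
    by (simp add: copy_letters_def sorting_positions_eq_swaps[OF c \<pi>] T_def)
  show ?thesis
  proof
    assume sort: "sortable n c \<pi>"
    show "\<forall>i. i + length c \<in> T \<longrightarrow> i \<in> T"
    proof (intro allI impI)
      fix i assume "i + length c \<in> T"
      then have "cyclic_word c (i + length c) \<in> copy_letters n c \<pi> (Suc (i div length c))"
        unfolding eq using len by (intro imageI) (simp add: div_add_self2)
      then have "cyclic_word c i \<in> copy_letters n c \<pi> (i div length c)"
        using sort by (auto simp: sortable_def)
      then obtain k where "k \<in> T" "k div length c = i div length c"
        "cyclic_word c i = cyclic_word c k"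
        by (auto simp: eq)
      then show "i \<in> T"
        by (metis cyclic_word_eq_iff[OF c] div_mult_mod_eq)
    qed
  next
    assume nest: "\<forall>i. i + length c \<in> T \<longrightarrow> i \<in> T"
    show "sortable n c \<pi>"
      unfolding sortable_def eq
    proof (intro allI subsetI)
      fix r a assume "a \<in> cyclic_word c ` {i \<in> T. i div length c = Suc r}"
      then obtain i where i: "i \<in> T" "i div length c = Suc r" "a = cyclic_word c i" by blast
      then have "length c \<le> i" by (metis div_less not_le nat.distinct(1))
      then obtain k where k: "i = k + length c" by (metis add.commute le_Suc_ex)
      then have "k \<in> {i \<in> T. i div length c = r}" "a = cyclic_word c k"
        using i nest len by (auto simp: div_add_self2)
      then show "a \<in> cyclic_word c ` {i \<in> T. i div length c = r}" by blast
    qed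
  qed
qed

subsection \<open>Sortability and pattern avoidance\<close>

text \<open>
  Position sequences: if \<open>f = inv \<pi>\<close>, then \<open>f x < f y\<close> says that \<open>x\<close> precedes \<open>y\<close> in the
  one-line notation of \<open>\<pi>\<close>.
\<close>

definition has_jki :: "nat \<Rightarrow> (nat \<Rightarrow> nat) \<Rightarrow> nat \<Rightarrow> bool" where
  "has_jki n f j \<longleftrightarrow> (\<exists>i k. 1 \<le> i \<and> i < j \<and> j < k \<and> k \<le> n \<and> f j < f k \<and> f k < f i)"

definition has_kij :: "nat \<Rightarrow> (nat \<Rightarrow> nat) \<Rightarrow> nat \<Rightarrow> bool" where
  "has_kij n f j \<longleftrightarrow> (\<exists>i k. 1 \<le> i \<and> i < j \<and> j < k \<and> k \<le> n \<and> f k < f i \<and> f i < f j)"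

text \<open>Condition (v) for the sequence \<open>f = inv \<pi>\<close>, with \<open>up_set\<close>
  and \<open>down_set\<close> unfolded to letter order so that rotations of \<open>c\<close> can be
  followed.\<close>

definition aligned :: "nat \<Rightarrow> nat list \<Rightarrow> (nat \<Rightarrow> nat) \<Rightarrow> bool" where
  "aligned n c f \<longleftrightarrow> (\<forall>j\<in>{2..n-1}.
     (appears_before c j (j - 1) \<longrightarrow> \<not> has_jki n f j) \<and>
     (appears_before c (j - 1) j \<longrightarrow> \<not> has_kij n f j))"

text \<open>For a permutation of \<open>{1..n}\<close> and \<open>1 \<le> a < n\<close> this is
  membership in the parabolic subgroup generated by the letters other than \<open>a\<close>.\<close>

definition separated :: "nat \<Rightarrow> nat \<Rightarrow> (nat \<Rightarrow> nat) \<Rightarrow> bool" where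
  "separated n a f \<longleftrightarrow> (\<forall>x y. 1 \<le> x \<and> x \<le> a \<and> a < y \<and> y \<le> n \<longrightarrow> f x < f y)"

lemma has_jki_range: "has_jki n f j \<Longrightarrow> j \<in> {2..n-1}"
  by (auto simp: has_jki_def)

lemma has_kij_range: "has_kij n f j \<Longrightarrow> j \<in> {2..n-1}"
  by (auto simp: has_kij_def)

section \<open>The pattern condition under rotation of the Coxeter word\<close>

lemma appears_before_Cons:
  "appears_before (a # c) x y \<longleftrightarrow> (x = a \<and> y \<in> set c) \<or> appears_before c x y"
proof
  assume "appears_before (a # c) x y"
  then obtain p q where pq: "p < q" "q < Suc (length c)" "(a # c) ! p = x" "(a # c) ! q = y"
    by (auto simp: appears_before_def)
  then obtain q' where q': "q = Suc q'" by (cases q) auto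
  show "(x = a \<and> y \<in> set c) \<or> appears_before c x y"
  proof (cases p)
    case 0
    with pq q' show ?thesis by auto
  next
    case (Suc p')
    with pq q' show ?thesis by (auto simp: appears_before_def)
  qed
next
  assume "(x = a \<and> y \<in> set c) \<or> appears_before c x y"
  then show "appears_before (a # c) x y"
  proof
    assume xy: "x = a \<and> y \<in> set c"
    then obtain q where "q < length c" "c ! q = y" by (auto simp: in_set_conv_nth)
    with xy have "0 < Suc q \<and> Suc q < length (a # c) \<and> (a # c) ! 0 = x \<and> (a # c) ! Suc q = y"
      by simp
    then show ?thesis unfolding appears_before_def by blast
  next
    assume "appears_before c x y"
    then obtain p q where "p < q" "q < length c" "c ! p = x" "c ! q = y"
      by (auto simp: appears_before_def)
    then have "Suc p < Suc q \<and> Suc q < length (a # c) \<and> (a # c) ! Suc p = x \<and> (a # c) ! Suc q = y"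
      by simp
    then show ?thesis unfolding appears_before_def by blast
  qed
qed

lemma appears_before_Nil [simp]: "\<not> appears_before [] x y"
  by (simp add: appears_before_def)

lemma appears_before_in_set: "appears_before c x y \<Longrightarrow> x \<in> set c \<and> y \<in> set c"
  by (auto simp: appears_before_def)

lemma appears_before_snoc:
  "appears_before (c @ [a]) x y \<longleftrightarrow> (y = a \<and> x \<in> set c) \<or> appears_before c x y"
  by (induction c) (auto simp: appears_before_Cons)

text \<open>The leading \<open>a\<close> precedes both neighbours, which decides the conditions at
  \<open>a\<close> and \<open>Suc a\<close>; for other \<open>j\<close> neither \<open>j\<close> nor
  \<open>j - 1\<close> is \<open>a\<close>. If a neighbour is not a letter (\<open>a = 1\<close> or
  \<open>Suc a = n\<close>), the pattern in question cannot occur at all.\<close>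

lemma aligned_Cons_iff:
  assumes "coxeter_word n (a # c)"
  shows "aligned n (a # c) f \<longleftrightarrow> \<not> has_jki n f a \<and> \<not> has_kij n f (Suc a) \<and>
    (\<forall>j\<in>{2..n-1} - {a, Suc a}. (appears_before c j (j - 1) \<longrightarrow> \<not> has_jki n f j) \<and>
     (appears_before c (j - 1) j \<longrightarrow> \<not> has_kij n f j))" (is "?l \<longleftrightarrow> ?r")
proof -
  have a: "a \<notin> set c" and ins: "insert a (set c) = {1..n-1}"
    using assms by (simp_all add: coxeter_word_def)
  have set: "x \<in> set c \<longleftrightarrow> x \<in> {1..n-1} \<and> x \<noteq> a" for x
    using a unfolding ins[symmetric] by blast
  have not: "\<not> appears_before c a x" "\<not> appears_before c x a" for x
    using a by (auto dest: appears_before_in_set)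
  have "a \<in> {2..n-1} \<and> appears_before (a # c) a (a - 1)" if "has_jki n f a"
  proof -
    have j: "a \<in> {2..n-1}" using has_jki_range[OF that] .
    then have "a - 1 \<in> set c" unfolding set by auto
    with j show ?thesis by (simp add: appears_before_Cons)
  qed
  moreover have "Suc a \<in> {2..n-1} \<and> appears_before (a # c) (Suc a - 1) (Suc a)" if "has_kij n f (Suc a)"
  proof -
    have j: "Suc a \<in> {2..n-1}" using has_kij_range[OF that] .
    then have "Suc a \<in> set c" unfolding set by auto
    with j show ?thesis by (simp add: appears_before_Cons)
  qed
  ultimately have "\<not> has_jki n f a" "\<not> has_kij n f (Suc a)" if ?l
    using that unfolding aligned_def by blast+
  moreover have "(appears_before c j (j - 1) \<longrightarrow> \<not> has_jki n f j) \<and>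
      (appears_before c (j - 1) j \<longrightarrow> \<not> has_kij n f j)" if ?l "j \<in> {2..n-1}" for j
    using that unfolding aligned_def appears_before_Cons by blast
  ultimately have "?r" if ?l using that by blast
  moreover have "?r \<Longrightarrow> ?l"
    unfolding aligned_def
  proof
    fix j assume r: ?r and j: "j \<in> {2..n-1}"
    then show "(appears_before (a # c) j (j - 1) \<longrightarrow> \<not> has_jki n f j) \<and>
      (appears_before (a # c) (j - 1) j \<longrightarrow> \<not> has_kij n f j)"
      using not a by (cases "j = a"; cases "j = Suc a") (auto simp: appears_before_Cons)
  qed
  ultimately show ?thesis by blast
qed

text \<open>In last place \<open>a\<close> follows both neighbours, so the two patterns exchange
  roles compared with \<open>aligned_Cons_iff\<close>.\<close>

lemma aligned_snoc_iff:
  assumes "coxeter_word n (c @ [a])"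
  shows "aligned n (c @ [a]) f \<longleftrightarrow> \<not> has_kij n f a \<and> \<not> has_jki n f (Suc a) \<and>
    (\<forall>j\<in>{2..n-1} - {a, Suc a}. (appears_before c j (j - 1) \<longrightarrow> \<not> has_jki n f j) \<and>
     (appears_before c (j - 1) j \<longrightarrow> \<not> has_kij n f j))" (is "?l \<longleftrightarrow> ?r")
proof -
  have a: "a \<notin> set c" and ins: "insert a (set c) = {1..n-1}"
    using assms by (simp_all add: coxeter_word_def)
  have set: "x \<in> set c \<longleftrightarrow> x \<in> {1..n-1} \<and> x \<noteq> a" for x
    using a unfolding ins[symmetric] by blast
  have not: "\<not> appears_before c a x" "\<not> appears_before c x a" for x
    using a by (auto dest: appears_before_in_set)
  have "a \<in> {2..n-1} \<and> appears_before (c @ [a]) (a - 1) a" if "has_kij n f a"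
  proof -
    have j: "a \<in> {2..n-1}" using has_kij_range[OF that] .
    then have "a - 1 \<in> set c" unfolding set by auto
    with j show ?thesis by (simp add: appears_before_snoc)
  qed
  moreover have "Suc a \<in> {2..n-1} \<and> appears_before (c @ [a]) (Suc a) (Suc a - 1)" if "has_jki n f (Suc a)"
  proof -
    have j: "Suc a \<in> {2..n-1}" using has_jki_range[OF that] .
    then have "Suc a \<in> set c" unfolding set by auto
    with j show ?thesis by (simp add: appears_before_snoc)
  qed
  ultimately have "\<not> has_kij n f a" "\<not> has_jki n f (Suc a)" if ?l
    using that unfolding aligned_def by blast+
  moreover have "(appears_before c j (j - 1) \<longrightarrow> \<not> has_jki n f j) \<and>
      (appears_before c (j - 1) j \<longrightarrow> \<not> has_kij n f j)" if ?l "j \<in> {2..n-1}" for j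
    using that unfolding aligned_def appears_before_snoc by blast
  ultimately have "?r" if ?l using that by blast
  moreover have "?r \<Longrightarrow> ?l"
    unfolding aligned_def
  proof
    fix j assume r: ?r and j: "j \<in> {2..n-1}"
    then show "(appears_before (c @ [a]) j (j - 1) \<longrightarrow> \<not> has_jki n f j) \<and>
      (appears_before (c @ [a]) (j - 1) j \<longrightarrow> \<not> has_kij n f j)"
      using not a by (cases "j = a"; cases "j = Suc a") (auto simp: appears_before_snoc)
  qed
  ultimately show ?thesis by blast
qed

lemma transpose_Suc_less_iff:
  assumes "j \<noteq> a" "j \<noteq> Suc a"
  shows "transpose a (Suc a) i < j \<longleftrightarrow> i < j" "j < transpose a (Suc a) i \<longleftrightarrow> j < i"
  using assms by (auto simp: transpose_def)

lemma transpose_Suc_bounds: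
  assumes "1 \<le> a" "a < n"
  shows "1 \<le> transpose a (Suc a) i \<longleftrightarrow> 1 \<le> i" "transpose a (Suc a) i \<le> n \<longleftrightarrow> i \<le> n"
  using assms by (auto simp: transpose_def)

text \<open>Swapping \<open>a\<close> and \<open>Suc a\<close> moves no index across any other
  \<open>j\<close>, so the witnesses \<open>i\<close> and \<open>k\<close> can be moved along. The
  swap is an involution, which gives the converse.\<close>

lemma has_jki_transpose:
  assumes "1 \<le> a" "a < n" "j \<noteq> a" "j \<noteq> Suc a"
  shows "has_jki n (f \<circ> transpose a (Suc a)) j \<longleftrightarrow> has_jki n f j"
proof -
  have imp: "has_jki n (g \<circ> transpose a (Suc a)) j" if g: "has_jki n g j" for g
  proof -
    obtain i k where "1 \<le> i \<and> i < j \<and> j < k \<and> k \<le> n \<and> g j < g k \<and> g k < g i"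
      using g unfolding has_jki_def by blast
    then show ?thesis
      unfolding has_jki_def using assms
      by (intro exI[of _ "transpose a (Suc a) i"] exI[of _ "transpose a (Suc a) k"])
        (simp add: transpose_Suc_less_iff transpose_Suc_bounds[simplified])
  qed
  from imp[of f] imp[of "f \<circ> transpose a (Suc a)"] show ?thesis
    by (auto simp: comp_assoc)
qed

lemma has_kij_transpose:
  assumes "1 \<le> a" "a < n" "j \<noteq> a" "j \<noteq> Suc a"
  shows "has_kij n (f \<circ> transpose a (Suc a)) j \<longleftrightarrow> has_kij n f j"
proof -
  have imp: "has_kij n (g \<circ> transpose a (Suc a)) j" if g: "has_kij n g j" for g
  proof -
    obtain i k where "1 \<le> i \<and> i < j \<and> j < k \<and> k \<le> n \<and> g k < g i \<and> g i < g j"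
      using g unfolding has_kij_def by blast
    then show ?thesis
      unfolding has_kij_def using assms
      by (intro exI[of _ "transpose a (Suc a) i"] exI[of _ "transpose a (Suc a) k"])
        (simp add: transpose_Suc_less_iff transpose_Suc_bounds[simplified])
  qed
  from imp[of f] imp[of "f \<circ> transpose a (Suc a)"] show ?thesis
    by (auto simp: comp_assoc)
qed

text \<open>The swap carries the entry \<open>f a\<close> to position \<open>Suc a\<close>, and with
  it the index \<open>j\<close> of the pattern. The descent keeps the other swapped entry from being
  one of the witnesses.\<close>

lemma has_jki_transpose_descent:
  assumes "1 \<le> a" "a < n" "f (Suc a) < f a"
  shows "has_jki n (f \<circ> transpose a (Suc a)) (Suc a) \<longleftrightarrow> has_jki n f a"
proof
  assume "has_jki n (f \<circ> transpose a (Suc a)) (Suc a)"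
  then obtain i k where "1 \<le> i" "i \<le> a" "Suc a < k" "k \<le> n" "f a < f k"
    "f k < f (transpose a (Suc a) i)"
    by (auto simp: has_jki_def less_Suc_eq_le)
  moreover from this assms have "i \<noteq> a" by auto
  ultimately show "has_jki n f a"
    unfolding has_jki_def by (intro exI[of _ i] exI[of _ k]) auto
next
  assume "has_jki n f a"
  then obtain i k where "1 \<le> i" "i < a" "a < k" "k \<le> n" "f a < f k" "f k < f i"
    by (auto simp: has_jki_def)
  moreover from this assms have "k \<noteq> Suc a" by auto
  ultimately show "has_jki n (f \<circ> transpose a (Suc a)) (Suc a)"
    unfolding has_jki_def by (intro exI[of _ i] exI[of _ k]) auto
qed

lemma has_kij_transpose_descent:
  assumes "1 \<le> a" "a < n" "f (Suc a) < f a"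
  shows "has_kij n (f \<circ> transpose a (Suc a)) a \<longleftrightarrow> has_kij n f (Suc a)"
proof
  assume "has_kij n (f \<circ> transpose a (Suc a)) a"
  then obtain i k where "1 \<le> i" "i < a" "a < k" "k \<le> n"
    "f (transpose a (Suc a) k) < f i" "f i < f (Suc a)"
    by (auto simp: has_kij_def)
  moreover from this assms have "k \<noteq> Suc a" by auto
  ultimately show "has_kij n f (Suc a)"
    unfolding has_kij_def by (intro exI[of _ i] exI[of _ k]) auto
next
  assume "has_kij n f (Suc a)"
  then obtain i k where "1 \<le> i" "i \<le> a" "Suc a < k" "k \<le> n" "f k < f i" "f i < f (Suc a)"
    by (auto simp: has_kij_def less_Suc_eq_le)
  moreover from this assms have "i \<noteq> a" by auto
  ultimately show "has_kij n (f \<circ> transpose a (Suc a)) a"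
    unfolding has_kij_def by (intro exI[of _ i] exI[of _ k]) auto
qed

text \<open>Rotation replaces the conditions \<open>has_jki\<close> at \<open>a\<close> and
  \<open>has_kij\<close> at \<open>Suc a\<close> by \<open>has_kij\<close> at \<open>a\<close> and
  \<open>has_jki\<close> at \<open>Suc a\<close>; the swap at a descent carries the former into the
  latter and leaves all other conditions alone.\<close>

lemma aligned_rotate_descent:
  assumes "coxeter_word n (a # c)" "f (Suc a) < f a"
  shows "aligned n (c @ [a]) (f \<circ> transpose a (Suc a)) \<longleftrightarrow> aligned n (a # c) f"
proof -
  have "coxeter_word n (c @ [a])" using assms by (auto simp: coxeter_word_def)
  moreover have "a \<in> {1..n-1}"
    using assms(1) unfolding coxeter_word_def by (metis list.set_intros(1))
  then have "1 \<le> a" "a < n" by auto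
  ultimately show ?thesis
    using assms
    by (simp add: aligned_Cons_iff aligned_snoc_iff has_jki_transpose has_kij_transpose
        has_jki_transpose_descent has_kij_transpose_descent) blast
qed

text \<open>All four patterns contain \<open>f k < f i\<close> with \<open>i \<le> a < k\<close>,
  which separation forbids.\<close>

lemma separated_patterns:
  assumes "separated n a f"
  shows "\<not> has_jki n f a" "\<not> has_kij n f a" "\<not> has_jki n f (Suc a)" "\<not> has_kij n f (Suc a)"
  using assms unfolding separated_def has_jki_def has_kij_def
  by (meson less_imp_le_nat less_Suc_eq_le not_less_iff_gr_or_eq less_trans Suc_lessD)+

lemma aligned_rotate_separated:
  assumes "coxeter_word n (a # c)" "separated n a f"
  shows "aligned n (c @ [a]) f \<longleftrightarrow> aligned n (a # c) f"
proof -
  have "coxeter_word n (c @ [a])" using assms by (auto simp: coxeter_word_def)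
  with assms separated_patterns[OF assms(2)] show ?thesis
    by (simp add: aligned_Cons_iff aligned_snoc_iff)
qed

text \<open>A pair \<open>x \<le> a < y\<close> in the wrong order completes a pattern forbidden by
  the leading \<open>a\<close>: if \<open>f a < f y\<close>, then \<open>a, y, x\<close> is a
  \<open>jki\<close>; otherwise, by the ascent, \<open>y, a, Suc a\<close> is a
  \<open>kij\<close>.\<close>

lemma aligned_ascent_separated:
  assumes c: "coxeter_word n (a # c)" and f: "inj f" and al: "aligned n (a # c) f"
    and asc: "f a < f (Suc a)"
  shows "separated n a f"
proof (rule ccontr)
  assume "\<not> separated n a f"
  then obtain x y where xy: "1 \<le> x" "x \<le> a" "a < y" "y \<le> n" "\<not> f x < f y"
    by (auto simp: separated_def)
  have "f x \<noteq> f y" "f a \<noteq> f y" using xy f by (simp_all add: inj_eq)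
  with xy have yx: "f y < f x" by simp
  have pat: "\<not> has_jki n f a" "\<not> has_kij n f (Suc a)"
    using al by (simp_all add: aligned_Cons_iff[OF c])
  show False
  proof (cases "f a < f y")
    case True
    with yx have "x \<noteq> a" by auto
    with True yx xy have "has_jki n f a"
      unfolding has_jki_def by (intro exI[of _ x] exI[of _ y]) simp
    with pat show False by simp
  next
    case False
    with \<open>f a \<noteq> f y\<close> have "f y < f a" by simp
    moreover from this asc have "y \<noteq> Suc a" by auto
    ultimately have "has_kij n f (Suc a)"
      using xy asc unfolding has_kij_def by (intro exI[of _ a] exI[of _ y]) simp
    with pat show False by simp
  qed
qed

section \<open>Separation along the bubble sort\<close>

lemma separated_transpose:
  assumes "1 \<le> b" "b < n" "b \<noteq> a"
  shows "separated n a (f \<circ> transpose b (Suc b)) \<longleftrightarrow> separated n a f"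
proof -
  have iff: "transpose b (Suc b) x \<le> a \<longleftrightarrow> x \<le> a" "a < transpose b (Suc b) x \<longleftrightarrow> a < x" for x
    using assms by (auto simp: transpose_def)
  have imp: "separated n a (g \<circ> transpose b (Suc b))" if "separated n a g" for g
    using that assms unfolding separated_def
    by (simp add: iff transpose_Suc_bounds[simplified])
  from imp[of f] imp[of "f \<circ> transpose b (Suc b)"] show ?thesis
    by (auto simp: comp_assoc)
qed

text \<open>Letters other than \<open>a\<close> permute entries on one side of the border after
  \<open>a\<close>, and the letter \<open>a\<close> itself always meets an ascent.\<close>

lemma separated_bubble:
  assumes "\<And>i. 1 \<le> s i" "\<And>i. s i < n" and "separated n a f"
  shows "separated n a (bubble s f i)"
proof (induction i)
  case (Suc i)
  have "\<not> bubble s f i (Suc a) < bubble s f i a" if "s i = a"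
    using Suc assms(1)[of i] assms(2)[of i] that by (simp add: separated_def less_imp_le not_less)
  with Suc show ?case
    using separated_transpose[OF assms(1,2), of i a "bubble s f i"] by (cases "s i = a") auto
qed (use assms in simp)

lemma separated_bubble_iff:
  assumes "\<And>i. 1 \<le> s i" "\<And>i. s i < n" and "\<And>i. s i = a \<Longrightarrow> i \<notin> swaps s f"
  shows "separated n a (bubble s f i) \<longleftrightarrow> separated n a f"
proof (induction i)
  case (Suc i)
  with assms(3)[of i] separated_transpose[OF assms(1,2), of i a "bubble s f i"] show ?case
    by (cases "s i = a") (auto simp: swaps_def)
qed simp

definition nested :: "nat list \<Rightarrow> (nat \<Rightarrow> nat) \<Rightarrow> bool" where
  "nested c f \<longleftrightarrow>
     (\<forall>i. i + length c \<in> swaps (cyclic_word c) f \<longrightarrow> i \<in> swaps (cyclic_word c) f)"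

lemma cyclic_word_rotate1: "c \<noteq> [] \<Longrightarrow> cyclic_word (rotate1 c) = (\<lambda>i. cyclic_word c (Suc i))"
  by (auto simp: cyclic_word_def nth_rotate1 mod_Suc_eq)

text \<open>Starting at the second letter shifts positions by one and loses only the implication
  from \<open>length c\<close> to \<open>0\<close>, which the second hypothesis supplies.\<close>

lemma nested_rotate:
  assumes c: "c \<noteq> []" and "0 \<in> swaps (cyclic_word c) f \<or> length c \<notin> swaps (cyclic_word c) f"
  shows "nested (rotate1 c) (bubble (cyclic_word c) f 1) \<longleftrightarrow> nested c f"
proof -
  let ?T = "swaps (cyclic_word c) f"
  have "nested (rotate1 c) (bubble (cyclic_word c) f 1)
      \<longleftrightarrow> (\<forall>i. Suc i + length c \<in> ?T \<longrightarrow> Suc i \<in> ?T)"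
    unfolding nested_def cyclic_word_rotate1[OF c] length_rotate1 add_Suc Suc_in_swaps ..
  also have "\<dots> \<longleftrightarrow> nested c f"
    unfolding nested_def using assms by (metis add_0 not0_implies_Suc)
  finally show ?thesis .
qed

lemma swaps_empty_if_sorted:
  assumes "\<And>i. 1 \<le> s i" "\<And>i. s i < n" and "strict_mono_on {1..n} f"
  shows "swaps s f = {}"
proof -
  have "f (s i) < f (Suc (s i))" for i
    using assms(1)[of i] assms(2)[of i] by (intro strict_mono_onD[OF assms(3)]) auto
  then have asc: "\<not> f (Suc (s i)) < f (s i)" for i
    using less_asym by blast
  then have "bubble s f i = f" for i
    by (induction i) auto
  with asc show ?thesis by (simp add: swaps_def)
qed

text \<open>
  Induction on the number of letters read until the sequence is sorted. If the first letter
  \<open>a\<close> of \<open>c\<close> is skipped, each side forces \<open>a\<close> never to be used, i.e. \<open>f\<close> separates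
  \<open>{1..a}\<close> from \<open>{a+1..n}\<close>, and then the orders of \<open>a\<close> relative to \<open>a-1\<close> and \<open>a+1\<close> in
  \<open>c\<close> are irrelevant; so in every case \<open>c\<close> may be rotated.
\<close>

lemma nested_iff_aligned_aux:
  assumes "coxeter_word n c" "2 \<le> n" "inj f"
    and "strict_mono_on {1..n} (bubble (cyclic_word c) f N)"
  shows "nested c f \<longleftrightarrow> aligned n c f"
  using assms
proof (induction N arbitrary: c f)
  case 0
  then have sorted: "strict_mono_on {1..n} f" by simp
  have "nested c f"
    using swaps_empty_if_sorted[OF cyclic_word_bounds[OF 0(1,2)] sorted] by (simp add: nested_def)
  moreover have "\<not> has_jki n f j" "\<not> has_kij n f j" for j
    using strict_mono_onD[OF sorted] unfolding has_jki_def has_kij_def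
    by (meson atLeastAtMost_iff less_asym less_imp_le less_trans order_trans)+
  ultimately show ?case by (simp add: aligned_def)
next
  case (Suc N)
  obtain a d where cd: "c = a # d"
    using coxeter_word_nonempty[OF Suc.prems(1,2)] by (cases c) auto
  let ?s = "cyclic_word c" and ?T = "swaps (cyclic_word c) f" and ?f1 = "bubble (cyclic_word c) f 1"
  note c = Suc.prems(1,2)
  note ne = coxeter_word_nonempty[OF c]
  note bounds = cyclic_word_bounds[OF c]
  have s0: "?s 0 = a" by (simp add: cyclic_word_def cd)
  have sl: "?s (length c) = a" by (simp add: cyclic_word_def cd)
  have rot: "rotate1 c = d @ [a]" by (simp add: cd)
  have "coxeter_word n (rotate1 c)" using c by (simp add: coxeter_word_def)
  moreover have "strict_mono_on {1..n} (bubble (cyclic_word (rotate1 c)) ?f1 N)"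
    using Suc.prems(4) unfolding cyclic_word_rotate1[OF ne] bubble_Suc_shift .
  ultimately have IH: "nested (rotate1 c) ?f1 \<longleftrightarrow> aligned n (rotate1 c) ?f1"
    using Suc.IH Suc.prems inj_bubble by blast
  show ?case
  proof (cases "0 \<in> ?T")
    case True
    then have desc: "f (Suc a) < f a" by (simp add: swaps_def s0)
    then have "?f1 = f \<circ> transpose a (Suc a)" by (simp add: s0)
    then have "aligned n (rotate1 c) ?f1 \<longleftrightarrow> aligned n c f"
      using aligned_rotate_descent[of n a d f] c desc unfolding rot cd by simp
    then show ?thesis
      using IH nested_rotate[OF ne] True by blast
  next
    case False
    then have f1: "?f1 = f" by (simp add: swaps_def)
    have "f a \<noteq> f (Suc a)" using \<open>inj f\<close> by (simp add: inj_eq)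
    with False have asc: "f a < f (Suc a)" by (simp add: swaps_def s0)
    show ?thesis
    proof (cases "separated n a f")
      case True
      then have "separated n a (bubble ?s f (length c))"
        by (rule separated_bubble[OF bounds])
      \<comment> \<open>Position \<open>length c\<close> is the second occurrence of
        \<open>a\<close>; a separated sequence has no descent there.\<close>
      then have "length c \<notin> ?T"
        using bounds[of 0] by (simp add: swaps_def sl s0 separated_def less_imp_le not_less)
      then have "nested (rotate1 c) ?f1 \<longleftrightarrow> nested c f" by (intro nested_rotate ne) simp
      moreover have "aligned n (rotate1 c) f \<longleftrightarrow> aligned n c f"
        using c(1) True unfolding rot unfolding cd by (rule aligned_rotate_separated)
      ultimately show ?thesis using IH unfolding f1 by simp
    next
      case sep: False
      have "\<not> aligned n c f"
        using aligned_ascent_separated[of n a d f] c(1) \<open>inj f\<close> asc sep unfolding cd by blast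
      moreover have "\<not> nested c f"
      proof
        assume nest: "nested c f"
        \<comment> \<open>Position \<open>0\<close> was skipped, and nestedness hands the skip on to
          every later occurrence of \<open>a\<close>.\<close>
        have mult: "k * length c \<notin> ?T" for k
        proof (induction k)
          case (Suc k)
          then show ?case using nest unfolding nested_def by (metis add.commute mult_Suc)
        qed (use False in simp)
        have "i \<notin> ?T" if "?s i = a" for i
        proof -
          have "i mod length c = 0"
            using cyclic_word_eq_iff[OF c, of i 0] that s0 by simp
          then show ?thesis using mult[of "i div length c"] by (metis add_0_right div_mult_mod_eq)
        qed
        then have "separated n a (bubble ?s f (Suc N)) \<longleftrightarrow> separated n a f"
          by (rule separated_bubble_iff[OF bounds])
        \<comment> \<open>After \<open>Suc N\<close> letters the sequence is sorted, hence separated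
          at \<open>a\<close>; tracing this back contradicts \<open>sep\<close>.\<close>
        moreover have "separated n a (bubble ?s f (Suc N))"
          using Suc.prems(4) unfolding separated_def
          by (auto intro: strict_mono_onD)
        ultimately show False using sep by blast
      qed
      ultimately show ?thesis by blast
    qed
  qed
qed

lemma nested_iff_aligned:
  assumes "coxeter_word n c" "2 \<le> n" "inj f"
  shows "nested c f \<longleftrightarrow> aligned n c f"
  using bubble_eventually_sorted[OF assms] nested_iff_aligned_aux[OF assms] by metis

lemma sortable_iff_aligned:
  assumes "coxeter_word n c" "2 \<le> n" "\<pi> permutes {1..n}"
  shows "sortable n c \<pi> \<longleftrightarrow> aligned n c (inv \<pi>)"
  using sortable_iff_nested[OF assms] nested_iff_aligned[OF assms(1,2)]
    permutes_inj[OF permutes_inv[OF assms(3)]]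
  by (simp add: nested_def)

subsection \<open>Automata and pattern avoidance\<close>

lemma run_state_snoc: "run_state A (w @ [a]) = trans_fun A (run_state A w) a"
  by (simp add: run_state_def)

text \<open>Dead states are absorbing, so a run that ever died is dead at the end.\<close>

lemma accepts_iff_run_state:
  assumes "\<And>q a. q \<in> dead_states A \<Longrightarrow> trans_fun A q a \<in> dead_states A"
  shows "accepts A w \<longleftrightarrow> run_state A w \<notin> dead_states A"
proof
  assume "accepts A w"
  then show "run_state A w \<notin> dead_states A"
    unfolding accepts_def by (metis order_refl take_all)
next
  have absorb: "foldl (trans_fun A) q u \<in> dead_states A" if "q \<in> dead_states A" for q u
    using that by (induction u arbitrary: q) (auto intro: assms)
  assume "run_state A w \<notin> dead_states A"
  moreover have "run_state A w = foldl (trans_fun A) (run_state A (take k w)) (drop k w)" for k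
    unfolding run_state_def by (metis append_take_drop_id foldl_append)
  ultimately show "accepts A w"
    unfolding accepts_def using absorb by metis
qed

lemma run_state_product:
  "run_state (product_automaton K A) w = (\<lambda>k\<in>K. run_state (A k) w)"
proof (induction w rule: rev_induct)
  case Nil
  show ?case by (simp add: run_state_def product_automaton_def)
next
  case (snoc a w)
  show ?case
    unfolding run_state_snoc snoc by (auto simp: product_automaton_def restrict_def fun_eq_iff)
qed

text \<open>Dead states of the product are drawn from the product of the state sets, so component
  runs must stay in their state sets for the death of a component to count.\<close>

lemma accepts_product:
  assumes "\<And>k w. k \<in> K \<Longrightarrow> run_state (A k) w \<in> states (A k)"
  shows "accepts (product_automaton K A) w \<longleftrightarrow> (\<forall>k\<in>K. accepts (A k) w)"
proof -
  have "run_state (product_automaton K A) v \<in> dead_states (product_automaton K A)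
      \<longleftrightarrow> (\<exists>k\<in>K. run_state (A k) v \<in> dead_states (A k))" for v
    unfolding run_state_product using assms by (auto simp: product_automaton_def)
  then show ?thesis unfolding accepts_def by blast
qed

lemma run_state_U_in_states:
  assumes "1 \<le> j" "j \<le> n"
  shows "run_state (U_automaton n j) w \<in> states (U_automaton n j)"
proof (induction w rule: rev_induct)
  case Nil
  show ?case using assms by (simp add: run_state_def U_automaton_def)
next
  case (snoc a w)
  have "U_step n j q a \<in> states (U_automaton n j)" if "q \<in> states (U_automaton n j)" for q
    using that assms by (cases q) (auto simp: U_automaton_def image_iff)
  from this[OF snoc] show ?case
    unfolding run_state_snoc by (simp add: U_automaton_def)
qed

lemma run_state_D_in_states:
  assumes "1 \<le> j"
  shows "run_state (D_automaton j) w \<in> states (D_automaton j)"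
proof (induction w rule: rev_induct)
  case Nil
  show ?case using assms by (simp add: run_state_def D_automaton_def)
next
  case (snoc a w)
  have "D_step j q a \<in> states (D_automaton j)" if "q \<in> states (D_automaton j)" for q
    using that by (cases q) (auto simp: D_automaton_def image_iff)
  from this[OF snoc] show ?case
    unfolding run_state_snoc by (simp add: D_automaton_def)
qed

lemma accepts_U_iff: "accepts (U_automaton n j) w \<longleftrightarrow> run_state (U_automaton n j) w \<noteq> Dead"
  by (subst accepts_iff_run_state) (auto simp: U_automaton_def)

lemma accepts_D_iff: "accepts (D_automaton j) w \<longleftrightarrow> run_state (D_automaton j) w \<noteq> Dead"
  by (subst accepts_iff_run_state) (auto simp: D_automaton_def)

lemma accepts_P_iff:
  assumes "U \<subseteq> {1..n}" "D \<subseteq> {1..}"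
  shows "accepts (P_automaton n U D) w \<longleftrightarrow>
    (\<forall>j\<in>U. accepts (U_automaton n j) w) \<and> (\<forall>j\<in>D. accepts (D_automaton j) w)"
proof -
  have "run_state (case_sum (U_automaton n) D_automaton k) v
      \<in> states (case_sum (U_automaton n) D_automaton k)" if "k \<in> U <+> D" for k v
    using that subsetD[OF assms(1)] subsetD[OF assms(2)]
    by (fastforce intro!: run_state_U_in_states run_state_D_in_states)
  then have "accepts (P_automaton n U D) w \<longleftrightarrow>
      (\<forall>k\<in>U <+> D. accepts (case_sum (U_automaton n) D_automaton k) w)"
    unfolding P_automaton_def by (rule accepts_product)
  then show ?thesis by (simp add: Plus_def ball_Un)
qed

text \<open>A prefix has at most as many inversions as letters, and one letter adds at most one;
  equality for \<open>w @ [a]\<close> therefore forces equality for \<open>w\<close> and a gain at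
  \<open>a\<close>.\<close>

lemma reduced_snoc_ascent:
  assumes "set (w @ [a]) \<subseteq> {1..n-1}"
    and "card (inversions n (word_perm (w @ [a]))) = length (w @ [a])"
  shows "card (inversions n (word_perm w)) = length w" "word_perm w a < word_perm w (Suc a)"
proof -
  have a: "1 \<le> a" "a < n" and w: "set w \<subseteq> {1..n-1}" using assms(1) by auto
  have le: "card (inversions n (word_perm w)) \<le> length w"
    using card_inversions_word_perm_le[OF w] .
  have card: "card (inversions n (word_perm w \<circ> transpose a (Suc a))) = Suc (length w)"
    using assms(2) unfolding word_perm_snoc by simp
  have "word_perm w a \<noteq> word_perm w (Suc a)"
    using permutes_inj[OF word_perm_permutes[OF w]] by (simp add: inj_eq)
  moreover have "\<not> word_perm w (Suc a) < word_perm w a"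
    using card_inversions_descent[OF a] card le by fastforce
  ultimately show asc: "word_perm w a < word_perm w (Suc a)" by simp
  show "card (inversions n (word_perm w)) = length w"
    using card_inversions_ascent[OF a asc] card by simp
qed

definition U_clear :: "nat \<Rightarrow> nat \<Rightarrow> nat \<Rightarrow> (nat \<Rightarrow> nat) \<Rightarrow> bool" where
  "U_clear n j m g \<longleftrightarrow> (\<forall>q. m < q \<and> q \<le> n \<longrightarrow> j < g q) \<and>
     (\<forall>p q. 1 \<le> p \<and> p \<le> m \<and> 1 \<le> q \<and> q \<le> m \<and> g p = j \<and> j < g q \<longrightarrow> q < p)"

text \<open>In \<open>H m\<close> with \<open>m < n\<close> the value \<open>j\<close> stands at
  position \<open>m\<close>; in \<open>I m\<close> it has been moved strictly to the left of
  \<open>m\<close>. \<open>H n\<close> leaves its position open, and \<open>Dead\<close> carries no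
  information.\<close>

fun U_inv :: "nat \<Rightarrow> nat \<Rightarrow> (nat \<Rightarrow> nat) \<Rightarrow> state \<Rightarrow> bool" where
  "U_inv n j g (H m) \<longleftrightarrow> j \<le> m \<and> m \<le> n \<and> U_clear n j m g \<and> (m < n \<longrightarrow> g m = j)"
| "U_inv n j g (I m) \<longleftrightarrow> j \<le> m \<and> m < n \<and> U_clear n j m g \<and> g m \<noteq> j"
| "U_inv n j g q \<longleftrightarrow> q = Dead"

text \<open>Mirror image of \<open>U_clear\<close>: left and right are exchanged, and so are smaller
  and larger values.\<close>

definition D_clear :: "nat \<Rightarrow> nat \<Rightarrow> nat \<Rightarrow> (nat \<Rightarrow> nat) \<Rightarrow> bool" where
  "D_clear n j m g \<longleftrightarrow> (\<forall>q. 1 \<le> q \<and> q < m \<longrightarrow> g q < j) \<and>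
     (\<forall>p q. m \<le> p \<and> p \<le> n \<and> m \<le> q \<and> q \<le> n \<and> g p = j \<and> g q < j \<longrightarrow> p < q)"

fun D_inv :: "nat \<Rightarrow> nat \<Rightarrow> (nat \<Rightarrow> nat) \<Rightarrow> state \<Rightarrow> bool" where
  "D_inv n j g (G m) \<longleftrightarrow> 1 \<le> m \<and> m \<le> j \<and> D_clear n j m g \<and> (1 < m \<longrightarrow> g m = j)"
| "D_inv n j g (J m) \<longleftrightarrow> 2 \<le> m \<and> m \<le> j \<and> D_clear n j m g \<and> g m \<noteq> j"
| "D_inv n j g q \<longleftrightarrow> q = Dead"

text \<open>For \<open>a \<noteq> m\<close> no entry crosses the border after position
  \<open>m\<close>. A larger value directly left of \<open>j\<close> forms a descent with it, so a
  swap at an ascent never brings it to the right of \<open>j\<close>.\<close>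

lemma U_clear_transpose:
  assumes "1 \<le> a" "a < n" "g a < g (Suc a)" "a \<noteq> m" "U_clear n j m g"
  shows "U_clear n j m (g \<circ> transpose a (Suc a))"
proof -
  let ?t = "transpose a (Suc a)"
  have side: "?t q \<le> m \<longleftrightarrow> q \<le> m" "m < ?t q \<longleftrightarrow> m < q" for q
    using \<open>a \<noteq> m\<close> by (auto simp: transpose_def)
  note bd = transpose_Suc_bounds[OF assms(1,2)]
  have "q < p" if "1 \<le> p" "p \<le> m" "1 \<le> q" "q \<le> m" "g (?t p) = j" "j < g (?t q)" for p q
  proof -
    have "?t q < ?t p"
      using assms(5) that side(1) bd(1) unfolding U_clear_def by blast
    moreover have "\<not> (?t q = a \<and> ?t p = Suc a)" using that assms(3) by auto
    ultimately show ?thesis by (auto simp: transpose_def split: if_splits)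
  qed
  moreover have "j < g (?t q)" if "m < q" "q \<le> n" for q
    using assms(5) that side(2) bd(2) unfolding U_clear_def by blast
  ultimately show ?thesis unfolding U_clear_def by simp
qed

text \<open>The border now lies just before position \<open>m\<close>, so the letter that crosses it
  is \<open>m - 1\<close>.\<close>

lemma D_clear_transpose:
  assumes "1 \<le> a" "a < n" "g a < g (Suc a)" "Suc a \<noteq> m" "D_clear n j m g"
  shows "D_clear n j m (g \<circ> transpose a (Suc a))"
proof -
  let ?t = "transpose a (Suc a)"
  have side: "m \<le> ?t q \<longleftrightarrow> m \<le> q" "?t q < m \<longleftrightarrow> q < m" for q
    using \<open>Suc a \<noteq> m\<close> by (auto simp: transpose_def)
  note bd = transpose_Suc_bounds[OF assms(1,2)]
  have "p < q" if "m \<le> p" "p \<le> n" "m \<le> q" "q \<le> n" "g (?t p) = j" "g (?t q) < j" for p q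
  proof -
    have "?t p < ?t q"
      using assms(5) that side(1) bd(2) unfolding D_clear_def by blast
    moreover have "\<not> (?t p = a \<and> ?t q = Suc a)" using that assms(3) by auto
    ultimately show ?thesis by (auto simp: transpose_def split: if_splits)
  qed
  moreover have "g (?t q) < j" if "1 \<le> q" "q < m" for q
    using assms(5) that side(2) bd(1) unfolding D_clear_def by blast
  ultimately show ?thesis unfolding D_clear_def by simp
qed

lemma U_inv_step:
  assumes g: "inj g" and a: "1 \<le> a" "a < n" "g a < g (Suc a)" and inv: "U_inv n j g q"
  shows "U_inv n j (g \<circ> transpose a (Suc a)) (U_step n j q a)"
proof (cases q)
  case (H m)
  note inv = inv[unfolded H]
  show ?thesis
  proof (cases "m < n \<and> a = m")
    case True
    then have gm: "g m = j" "j \<le> m" using inv by auto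
    \<comment> \<open>The larger value that enters the first \<open>Suc m\<close> positions lands at
      \<open>m\<close>, just left of \<open>j\<close>, which moves to \<open>Suc m\<close>.\<close>
    have "U_clear n j (Suc m) (g \<circ> transpose a (Suc a))"
      unfolding U_clear_def
    proof (intro conjI allI impI; elim conjE)
      fix p assume "Suc m < p" "p \<le> n"
      then show "j < (g \<circ> transpose a (Suc a)) p"
        using inv True by (auto simp: U_clear_def transpose_def)
    next
      fix p q assume "q \<le> Suc m" "(g \<circ> transpose a (Suc a)) p = j" "j < (g \<circ> transpose a (Suc a)) q"
      moreover from this have "transpose a (Suc a) p = m" using g gm by (auto simp: inj_eq)
      then have "p = Suc m" using True by (auto simp: transpose_def split: if_splits)
      ultimately show "q < p" using gm True by (cases "q = Suc m") auto
    qed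
    then show ?thesis using True gm H by auto
  next
    case F1: False
    show ?thesis
    proof (cases "m < n \<and> a = m - 1")
      case True
      then have m: "m = Suc a" "g m = j" "m < n" "j \<le> m" using inv a by auto
      have "U_clear n j m (g \<circ> transpose a (Suc a))"
        using U_clear_transpose[OF a] inv m by auto
      moreover have "U_step n j q a = I m" using H m by simp
      moreover have "(g \<circ> transpose a (Suc a)) m \<noteq> j" using m a(3) by simp
      ultimately show ?thesis using m by simp
    next
      case False
      have "U_clear n j m (g \<circ> transpose a (Suc a))"
        using U_clear_transpose[OF a] F1 inv a by (cases "a = m") auto
      moreover have "g (transpose a (Suc a) m) = j" if "m < n"
        using that F1 False inv by (auto simp: transpose_def)
      ultimately show ?thesis using H F1 False inv a(1,2) by auto
    qed
  qed
next
  case (I m)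
  note inv = inv[unfolded I]
  show ?thesis
  proof (cases "a = m")
    case True
    then show ?thesis using I inv by auto
  next
    case False
    have clear: "U_clear n j m (g \<circ> transpose a (Suc a))"
      using U_clear_transpose[OF a False] inv by auto
    have "g (transpose a (Suc a) m) \<noteq> j"
    proof (cases "m = Suc a")
      case True
      \<comment> \<open>Bringing \<open>j\<close> back to position \<open>m\<close> by an ascending
        swap would require a larger value to its right within the first \<open>m\<close>
        positions.\<close>
      have "\<not> (g a = j \<and> j < g m)"
        using inv a True unfolding U_inv.simps U_clear_def by (metis le_add1 lessI less_asym nat_less_le order_refl plus_1_eq_Suc)
      then show ?thesis using a True by auto
    qed (use False inv in \<open>auto simp: transpose_def\<close>)
    with clear show ?thesis using I inv False by auto
  qed
qed (use inv in auto)

text \<open>Mirror image of \<open>U_inv_step\<close>: in \<open>G m\<close> the letter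
  \<open>m - 1\<close> moves \<open>j\<close> one place left, while the letter \<open>m\<close>
  moves it right and makes the state ill.\<close>

lemma D_inv_step:
  assumes g: "inj g" and a: "1 \<le> a" "a < n" "g a < g (Suc a)" and inv: "D_inv n j g q" and j: "j < n"
  shows "D_inv n j (g \<circ> transpose a (Suc a)) (D_step j q a)"
proof (cases q)
  case (G m)
  note inv = inv[unfolded G]
  show ?thesis
  proof (cases "1 < m \<and> Suc a = m")
    case True
    then have gm: "g m = j" "m \<le> j" using inv by auto
    have "D_clear n j a (g \<circ> transpose a (Suc a))"
      unfolding D_clear_def
    proof (intro conjI allI impI; elim conjE)
      fix p assume "1 \<le> p" "p < a"
      then show "(g \<circ> transpose a (Suc a)) p < j"
        using inv True by (auto simp: D_clear_def transpose_def)
    next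
      fix p q assume "a \<le> q" "(g \<circ> transpose a (Suc a)) p = j" "(g \<circ> transpose a (Suc a)) q < j"
      moreover from this have "transpose a (Suc a) p = m" using g gm by (auto simp: inj_eq)
      then have "p = a" using True by (auto simp: transpose_def split: if_splits)
      ultimately show "p < q" using gm True by (cases "q = a") auto
    qed
    then show ?thesis using True gm G a by auto
  next
    case F1: False
    show ?thesis
    proof (cases "1 < m \<and> a = m")
      case True
      then have m: "g a = j" using inv by auto
      have "D_clear n j m (g \<circ> transpose a (Suc a))"
        using D_clear_transpose[OF a] inv True by auto
      moreover have "D_step j q a = J m" using G True inv by auto
      moreover have "(g \<circ> transpose a (Suc a)) m \<noteq> j" using True m a(3) by simp
      moreover have "2 \<le> m" "m \<le> j" using inv True by auto
      ultimately show ?thesis by simp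
    next
      case False
      have "D_clear n j m (g \<circ> transpose a (Suc a))"
        using D_clear_transpose[OF a] F1 inv a by (cases "Suc a = m") auto
      moreover have "g (transpose a (Suc a) m) = j" if "1 < m"
        using that F1 False inv by (auto simp: transpose_def)
      ultimately show ?thesis using G F1 False inv a by auto
    qed
  qed
next
  case (J m)
  note inv = inv[unfolded J]
  show ?thesis
  proof (cases "Suc a = m")
    case True
    then show ?thesis using J inv by auto
  next
    case False
    have clear: "D_clear n j m (g \<circ> transpose a (Suc a))"
      using D_clear_transpose[OF a False] inv by auto
    have "g (transpose a (Suc a) m) \<noteq> j"
    proof (cases "m = a")
      case True
      have "\<not> (g (Suc a) = j \<and> g m < j)"
        using inv a True unfolding D_inv.simps D_clear_def by (metis Suc_leI le_SucI less_imp_le_nat not_less_eq order_refl less_irrefl_nat lessI less_asym)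
      then show ?thesis using a True by auto
    qed (use False inv in \<open>auto simp: transpose_def\<close>)
    with clear show ?thesis using J inv False a by auto
  qed
qed (use inv in auto)

section \<open>Accepted reduced words certify pattern avoidance\<close>

lemma U_inv_run_state:
  assumes "set w \<subseteq> {1..n-1}" "card (inversions n (word_perm w)) = length w" "j \<le> n"
  shows "U_inv n j (word_perm w) (run_state (U_automaton n j) w)"
  using assms(1,2)
proof (induction w rule: rev_induct)
  case Nil
  show ?case using assms(3) by (auto simp: run_state_def U_automaton_def U_clear_def)
next
  case (snoc a w)
  note red = reduced_snoc_ascent[OF snoc.prems]
  have w: "set w \<subseteq> {1..n-1}" and a: "1 \<le> a" "a < n" using snoc.prems(1) by auto
  have "U_inv n j (word_perm w \<circ> transpose a (Suc a)) (U_step n j (run_state (U_automaton n j) w) a)"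
    using U_inv_step[OF permutes_inj[OF word_perm_permutes[OF w]] a red(2) snoc.IH[OF w red(1)]] .
  then show ?case
    unfolding run_state_snoc word_perm_snoc by (simp add: U_automaton_def o_def)
qed

lemma D_inv_run_state:
  assumes "set w \<subseteq> {1..n-1}" "card (inversions n (word_perm w)) = length w" "1 \<le> j" "j < n"
  shows "D_inv n j (word_perm w) (run_state (D_automaton j) w)"
  using assms(1,2)
proof (induction w rule: rev_induct)
  case Nil
  show ?case using assms(3) by (auto simp: run_state_def D_automaton_def D_clear_def)
next
  case (snoc a w)
  note red = reduced_snoc_ascent[OF snoc.prems]
  have w: "set w \<subseteq> {1..n-1}" and a: "1 \<le> a" "a < n" using snoc.prems(1) by auto
  have "D_inv n j (word_perm w \<circ> transpose a (Suc a)) (D_step j (run_state (D_automaton j) w) a)"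
    using D_inv_step[OF permutes_inj[OF word_perm_permutes[OF w]] a red(2) snoc.IH[OF w red(1)] assms(4)] .
  then show ?case
    unfolding run_state_snoc word_perm_snoc by (simp add: D_automaton_def o_def)
qed

text \<open>The smaller value cannot stand right of position \<open>m\<close>, so the whole pattern
  lies in the first \<open>m\<close> positions, where larger values stand left of
  \<open>j\<close>.\<close>

lemma avoids_jki_if_U_clear:
  assumes "U_clear n j m g"
  shows "avoids_jki n g j"
proof -
  have False if "1 \<le> p" "p < q" "q < r" "r \<le> n" "g p = j" "j < g q" "g r < j" for p q r
  proof -
    have "\<not> m < r" using assms that unfolding U_clear_def by (blast dest: less_asym)
    with that have "p \<le> m" "1 \<le> q" "q \<le> m" by auto
    with assms that have "q < p" unfolding U_clear_def by blast
    with that show False by simp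
  qed
  then show ?thesis unfolding avoids_jki_def in_order_def by blast
qed

lemma avoids_kij_if_D_clear:
  assumes "D_clear n j m g"
  shows "avoids_kij n g j"
proof -
  have False if "1 \<le> p" "p < q" "q < r" "r \<le> n" "j < g p" "g q < j" "g r = j" for p q r
  proof -
    have "\<not> p < m" using assms that unfolding D_clear_def by (blast dest: less_asym)
    with that have "m \<le> r" "m \<le> q" "q \<le> n" by auto
    with assms that have "r < q" unfolding D_clear_def by blast
    with that show False by simp
  qed
  then show ?thesis unfolding avoids_kij_def in_order_def by blast
qed

text \<open>Healthy and ill final states alike provide \<open>U_clear\<close> for some
  \<open>m\<close>; acceptance excludes \<open>Dead\<close>.\<close>

lemma avoids_jki_if_accepts_U:
  assumes "set w \<subseteq> {1..n-1}" "card (inversions n (word_perm w)) = length w" "j \<le> n"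
    and "accepts (U_automaton n j) w"
  shows "avoids_jki n (word_perm w) j"
  using U_inv_run_state[OF assms(1-3)] assms(4) unfolding accepts_U_iff
  by (cases "run_state (U_automaton n j) w") (auto intro: avoids_jki_if_U_clear)

lemma avoids_kij_if_accepts_D:
  assumes "set w \<subseteq> {1..n-1}" "card (inversions n (word_perm w)) = length w" "1 \<le> j" "j < n"
    and "accepts (D_automaton j) w"
  shows "avoids_kij n (word_perm w) j"
  using D_inv_run_state[OF assms(1-4)] assms(5) unfolding accepts_D_iff
  by (cases "run_state (D_automaton j) w") (auto intro: avoids_kij_if_D_clear)

subsection \<open>Runs on nested sorting words\<close>

text \<open>Equal letters lie a multiple of \<open>length c\<close> apart, and nestedness passes a
  skip on from each copy to the next.\<close>

lemma skipped_stays_skipped: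
  assumes c: "coxeter_word n c" "2 \<le> n" and nest: "\<And>i. i + length c \<in> T \<Longrightarrow> i \<in> T"
    and k: "k \<notin> T" "k \<le> i" "cyclic_word c k = cyclic_word c i"
  shows "i \<notin> T"
proof -
  have "length c dvd i - k"
    using k cyclic_word_eq_iff[OF c, of i k] by (simp add: mod_eq_dvd_iff_nat)
  then obtain d where "i - k = d * length c" by (metis dvdE mult.commute)
  then have i: "i = k + d * length c" using k(2) by simp
  have "k + d * length c \<notin> T" for d
  proof (induction d)
    case (Suc d)
    then show ?case using nest[of "k + d * length c"] by (auto simp: algebra_simps)
  qed (use k in simp)
  then show ?thesis unfolding i .
qed

text \<open>Two occurrences of one letter are at least a full period apart, and the first
  \<open>x\<close> from \<open>k\<close> on comes within one period.\<close>

lemma cyclic_word_between: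
  assumes c: "coxeter_word n c" "2 \<le> n" and k: "k < i" "cyclic_word c k = cyclic_word c i"
    and x: "1 \<le> x" "x < n" "x \<noteq> cyclic_word c i"
  obtains l where "k < l" "l < i" "cyclic_word c l = x"
proof -
  let ?P = "\<lambda>l. k \<le> l \<and> cyclic_word c l = x"
  define l where "l = (LEAST l. ?P l)"
  have "\<exists>l. ?P l" using cyclic_word_surj[OF c(1) x(1,2), of k] by metis
  then have l: "?P l" unfolding l_def by (rule LeastI_ex)
  have "length c dvd i - k" "0 < i - k"
    using k cyclic_word_eq_iff[OF c, of i k] by (simp_all add: mod_eq_dvd_iff_nat)
  then have "length c \<le> i - k" by (rule dvd_imp_le)
  then have i: "k + length c \<le> i" using k(1) by linarith
  have "l < k + length c"
  proof (rule ccontr)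
    assume "\<not> l < k + length c"
    then obtain l' where l': "l = l' + length c" "k \<le> l'"
      by (metis add.commute add_le_cancel_right le_Suc_ex le_add2 not_less order_trans)
    then have "?P l'" using l by simp
    then have "l \<le> l'" unfolding l_def by (rule Least_le)
    with l' coxeter_word_nonempty[OF c] show False by simp
  qed
  with i have "l < i" by simp
  moreover have "k < l" using l k(2) x(3) by (metis le_neq_implies_less)
  ultimately show ?thesis using that l by blast
qed

text \<open>The earliest \<open>y\<close> lies in the first copy of \<open>c\<close>, where
  \<open>x\<close> already stands before it.\<close>

lemma appears_before_cyclic_word:
  assumes c: "coxeter_word n c" "2 \<le> n" and "appears_before c x y" "cyclic_word c i = y"
  obtains k where "k < i" "cyclic_word c k = x"
proof -
  obtain p q where pq: "p < q" "q < length c" "c ! p = x" "c ! q = y"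
    using assms(3) unfolding appears_before_def by blast
  then have "cyclic_word c q = cyclic_word c i" using assms(4) by (simp add: cyclic_word_def)
  then have "i mod length c = q" using cyclic_word_eq_iff[OF c, of q i] pq by simp
  then have "p < i" using pq(1) mod_less_eq_dividend[of i "length c"] by linarith
  moreover have "cyclic_word c p = x" using pq by (simp add: cyclic_word_def)
  ultimately show ?thesis using that by blast
qed

text \<open>
  If \<open>x\<close> is idle with respect to \<open>y\<close> and the next letter of \<open>c\<^sup>\<infinity>\<close> is \<open>y\<close>, then
  an occurrence of \<open>x\<close> has been skipped; in a nested position set \<open>x\<close> is then never used again.
\<close>

definition idle :: "nat list \<Rightarrow> nat set \<Rightarrow> nat \<Rightarrow> nat \<Rightarrow> nat \<Rightarrow> bool" where
  "idle c T x y i \<longleftrightarrow>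
     (appears_before c x y \<and> (\<forall>k<i. k \<in> T \<longrightarrow> cyclic_word c k \<noteq> x)) \<or>
     (\<exists>l<i. cyclic_word c l = y \<and> (\<forall>k. l < k \<and> k < i \<and> k \<in> T \<longrightarrow> cyclic_word c k \<noteq> x))"

lemma idle_0: "appears_before c x y \<Longrightarrow> idle c T x y 0"
  by (simp add: idle_def)

lemma idle_start: "cyclic_word c i = y \<Longrightarrow> idle c T x y (Suc i)"
  unfolding idle_def by (metis lessI less_Suc_eq_le not_le)

lemma idle_Suc: "idle c T x y i \<Longrightarrow> (i \<in> T \<Longrightarrow> cyclic_word c i \<noteq> x) \<Longrightarrow> idle c T x y (Suc i)"
  unfolding idle_def by (metis less_Suc_eq)

lemma idle_unused:
  assumes c: "coxeter_word n c" "2 \<le> n" and nest: "\<And>i. i + length c \<in> T \<Longrightarrow> i \<in> T"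
    and idle: "idle c T x y i" and i: "cyclic_word c i = y"
    and x: "1 \<le> x" "x < n" "x \<noteq> y"
    and k: "i \<le> k" "k \<in> T"
  shows "cyclic_word c k \<noteq> x"
proof -
  from idle obtain l where l: "l < i" "cyclic_word c l = x" "l \<notin> T"
    unfolding idle_def
  proof (elim disjE exE conjE)
    assume "appears_before c x y" and unused: "\<forall>k<i. k \<in> T \<longrightarrow> cyclic_word c k \<noteq> x"
    then obtain l where "l < i" "cyclic_word c l = x"
      using appears_before_cyclic_word[OF c _ i] by metis
    with unused show ?thesis using that by blast
  next
    fix h assume h: "h < i" "cyclic_word c h = y"
      and unused: "\<forall>k. h < k \<and> k < i \<and> k \<in> T \<longrightarrow> cyclic_word c k \<noteq> x"
    obtain l where "h < l" "l < i" "cyclic_word c l = x"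
      using cyclic_word_between[OF c h(1), of x] h(2) i x by metis
    with unused show ?thesis using that by blast
  qed
  then show ?thesis using skipped_stays_skipped[OF c nest l(3), of k] k by auto
qed

text \<open>Soundness looks at the use of letters, not at the permutation. \<open>H m\<close> with
  \<open>m < n\<close> records that \<open>m\<close> is idle with respect to \<open>m - 1\<close>,
  so that illness implies a skipped \<open>m\<close>; \<open>I m\<close> records that
  \<open>m\<close> is used no more.\<close>

fun U_sound :: "nat \<Rightarrow> nat \<Rightarrow> nat list \<Rightarrow> nat set \<Rightarrow> nat \<Rightarrow> state \<Rightarrow> bool" where
  "U_sound n j c T i (H m) \<longleftrightarrow> j \<le> m \<and> m \<le> n \<and> (m < n \<longrightarrow> idle c T m (m - 1) i)"
| "U_sound n j c T i (I m) \<longleftrightarrow> (\<forall>k\<ge>i. k \<in> T \<longrightarrow> cyclic_word c k \<noteq> m)"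
| "U_sound n j c T i q \<longleftrightarrow> False"

fun D_sound :: "nat \<Rightarrow> nat list \<Rightarrow> nat set \<Rightarrow> nat \<Rightarrow> state \<Rightarrow> bool" where
  "D_sound j c T i (G m) \<longleftrightarrow> 1 \<le> m \<and> m \<le> j \<and> (1 < m \<longrightarrow> idle c T (m - 1) m i)"
| "D_sound j c T i (J m) \<longleftrightarrow> (\<forall>k\<ge>i. k \<in> T \<longrightarrow> cyclic_word c k \<noteq> m - 1)"
| "D_sound j c T i q \<longleftrightarrow> False"

lemma U_sound_step:
  assumes c: "coxeter_word n c" "2 \<le> n" and nest: "\<And>i. i + length c \<in> T \<Longrightarrow> i \<in> T"
    and j: "2 \<le> j" and q: "U_sound n j c T i q"
  shows "U_sound n j c T (Suc i) (if i \<in> T then U_step n j q (cyclic_word c i) else q)"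
proof (cases q)
  case (H m)
  then have m: "j \<le> m" "m \<le> n" "m < n \<Longrightarrow> idle c T m (m - 1) i" using q by auto
  consider "m = n" | "m < n" "i \<in> T" "cyclic_word c i = m"
    | "m < n" "i \<in> T" "cyclic_word c i = m - 1"
    | "m < n" "i \<in> T \<Longrightarrow> cyclic_word c i \<noteq> m \<and> cyclic_word c i \<noteq> m - 1"
    using m(2) by fastforce
  then show ?thesis
  proof cases
    case 1
    then show ?thesis using H m(1) j by auto
  next
    case 2
    \<comment> \<open>\<open>H (Suc m)\<close> watches the letter \<open>Suc m\<close>, which cannot
      have been used since the \<open>m\<close> just read.\<close>
    have "idle c T (Suc m) m (Suc i)" by (rule idle_start[OF 2(3)])
    then show ?thesis using H 2 m(1) by auto
  next
    case 3
    \<comment> \<open>The letter \<open>m - 1\<close> has come while \<open>m\<close> was idle, so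
      \<open>m\<close> is finished and the edge from \<open>I m\<close> to \<open>Dead\<close> is
      never taken.\<close>
    have "cyclic_word c k \<noteq> m" if "i \<le> k" "k \<in> T" for k
      by (rule idle_unused[OF c nest m(3)[OF 3(1)] 3(3) _ 3(1) _ that]) (use m(1) j in auto)
    moreover have "U_step n j q (cyclic_word c i) = I m"
      unfolding H 3(3) using m(1) j 3(1) by auto
    ultimately show ?thesis using 3(2) by simp
  next
    case 4
    have "idle c T m (m - 1) (Suc i)" using idle_Suc[OF m(3)] 4 by blast
    then show ?thesis using H 4 m by auto
  qed
next
  case (I m)
  then show ?thesis using q by (auto simp: Suc_le_eq)
qed (use q in auto)

lemma D_sound_step:
  assumes c: "coxeter_word n c" "2 \<le> n" and nest: "\<And>i. i + length c \<in> T \<Longrightarrow> i \<in> T"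
    and j: "j < n" and q: "D_sound j c T i q"
  shows "D_sound j c T (Suc i) (if i \<in> T then D_step j q (cyclic_word c i) else q)"
proof (cases q)
  case (G m)
  then have m: "1 \<le> m" "m \<le> j" "1 < m \<Longrightarrow> idle c T (m - 1) m i" using q by auto
  consider "m = 1" | "1 < m" "i \<in> T" "cyclic_word c i = m - 1"
    | "1 < m" "i \<in> T" "cyclic_word c i = m"
    | "1 < m" "i \<in> T \<Longrightarrow> cyclic_word c i \<noteq> m \<and> cyclic_word c i \<noteq> m - 1"
    using m(1) by fastforce
  then show ?thesis
  proof cases
    case 1
    then show ?thesis using G m(2) by auto
  next
    case 2
    \<comment> \<open>For \<open>m = 2\<close> this speaks of the letter \<open>0\<close>, but
      \<open>G 1\<close> asks for no idleness.\<close>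
    have "idle c T (m - 1 - 1) (m - 1) (Suc i)" by (rule idle_start[OF 2(3)])
    moreover have "D_step j q (cyclic_word c i) = G (m - 1)"
      unfolding G 2(3) using m(2) 2(1) by auto
    ultimately show ?thesis using 2(1,2) m(2) by auto
  next
    case 3
    have "cyclic_word c k \<noteq> m - 1" if "i \<le> k" "k \<in> T" for k
      by (rule idle_unused[OF c nest m(3)[OF 3(1)] 3(3) _ _ _ that]) (use m(2) j 3(1) in auto)
    moreover have "D_step j q (cyclic_word c i) = J m"
      unfolding G 3(3) using m(2) 3(1) by auto
    ultimately show ?thesis using 3(2) by simp
  next
    case 4
    have "idle c T (m - 1) m (Suc i)" using idle_Suc[OF m(3)] 4 by blast
    then show ?thesis using G 4 m by auto
  qed
next
  case (J m)
  then show ?thesis using q by (auto simp: Suc_le_eq)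
qed (use q in auto)

lemma run_state_subword_at_Suc:
  "run_state A (subword_at c (T \<inter> {..<Suc i})) =
    (let q = run_state A (subword_at c (T \<inter> {..<i}))
     in if i \<in> T then trans_fun A q (cyclic_word c i) else q)"
  unfolding subword_at_lessThan_Suc by (simp add: Let_def run_state_snoc)

lemma trans_fun_U: "trans_fun (U_automaton n j) = U_step n j"
  by (simp add: U_automaton_def)

lemma trans_fun_D: "trans_fun (D_automaton j) = D_step j"
  by (simp add: D_automaton_def)

text \<open>The start \<open>H j\<close> is sound because \<open>j\<close> precedes
  \<open>j - 1\<close> in \<open>c\<close>, the first alternative of \<open>idle\<close>.\<close>

lemma U_sound_run_state:
  assumes c: "coxeter_word n c" "2 \<le> n" and nest: "\<And>i. i + length c \<in> T \<Longrightarrow> i \<in> T"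
    and j: "j \<in> up_set n c"
  shows "U_sound n j c T i (run_state (U_automaton n j) (subword_at c (T \<inter> {..<i})))"
proof (induction i)
  case 0
  then show ?case
    using j by (auto simp: subword_at_def run_state_def U_automaton_def up_set_def idle_0)
next
  case (Suc i)
  have "2 \<le> j" using j by (simp add: up_set_def)
  from U_sound_step[OF c nest this Suc] show ?case
    unfolding run_state_subword_at_Suc Let_def trans_fun_U .
qed

lemma D_sound_run_state:
  assumes c: "coxeter_word n c" "2 \<le> n" and nest: "\<And>i. i + length c \<in> T \<Longrightarrow> i \<in> T"
    and j: "j \<in> down_set n c"
  shows "D_sound j c T i (run_state (D_automaton j) (subword_at c (T \<inter> {..<i})))"
proof (induction i)
  case 0
  then show ?case
    using j by (auto simp: subword_at_def run_state_def D_automaton_def down_set_def idle_0)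
next
  case (Suc i)
  have "j < n" using j by (auto simp: down_set_def)
  from D_sound_step[OF c nest this Suc] show ?case
    unfolding run_state_subword_at_Suc Let_def trans_fun_D .
qed

text \<open>Past the last swap the prefix read is the whole sorting word, and no sound state is
  \<open>Dead\<close>.\<close>

lemma sortable_accepts_sorting_word:
  assumes c: "coxeter_word n c" "2 \<le> n" and \<pi>: "\<pi> permutes {1..n}" and sort: "sortable n c \<pi>"
  shows "accepts (P_automaton n (up_set n c) (down_set n c)) (sorting_word n c \<pi>)"
proof -
  define T where "T = swaps (cyclic_word c) (inv \<pi>)"
  have nest: "i \<in> T" if "i + length c \<in> T" for i
    using sortable_iff_nested[OF c \<pi>] sort that unfolding T_def by blast
  have "finite T" unfolding T_def by (rule finite_swaps[OF cyclic_word_bounds[OF c]])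
  then obtain N where "\<forall>i\<in>T. i < N" unfolding finite_nat_set_iff_bounded ..
  then have TN: "T \<inter> {..<N} = T" by auto
  have word: "sorting_word n c \<pi> = subword_at c (T \<inter> {..<N})"
    unfolding TN by (simp add: sorting_word_def sorting_positions_eq_swaps[OF c \<pi>] T_def)
  have "accepts (U_automaton n j) (sorting_word n c \<pi>)" if "j \<in> up_set n c" for j
    unfolding accepts_U_iff word using U_sound_run_state[OF c nest that, of N] by auto
  moreover have "accepts (D_automaton j) (sorting_word n c \<pi>)" if "j \<in> down_set n c" for j
    unfolding accepts_D_iff word using D_sound_run_state[OF c nest that, of N] by auto
  moreover have "up_set n c \<subseteq> {1..n}" "down_set n c \<subseteq> {1..}"
    by (auto simp: up_set_def down_set_def)
  ultimately show ?thesis by (simp add: accepts_P_iff)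
qed

section \<open>From patterns in one-line notation to position sequences\<close>

lemma in_order_iff:
  assumes \<pi>: "\<pi> permutes {1..n}"
  shows "in_order n \<pi> x y z \<longleftrightarrow>
    x \<in> {1..n} \<and> z \<in> {1..n} \<and> inv \<pi> x < inv \<pi> y \<and> inv \<pi> y < inv \<pi> z"
proof
  assume "in_order n \<pi> x y z"
  then obtain p q r where *: "1 \<le> p" "p < q" "q < r" "r \<le> n" "x = \<pi> p" "y = \<pi> q" "z = \<pi> r"
    unfolding in_order_def by blast
  then have "p \<in> {1..n}" "r \<in> {1..n}" by auto
  then have "\<pi> p \<in> {1..n}" "\<pi> r \<in> {1..n}" unfolding permutes_in_image[OF \<pi>] .
  with * show "x \<in> {1..n} \<and> z \<in> {1..n} \<and> inv \<pi> x < inv \<pi> y \<and> inv \<pi> y < inv \<pi> z"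
    by (simp add: permutes_inverses[OF \<pi>])
next
  assume *: "x \<in> {1..n} \<and> z \<in> {1..n} \<and> inv \<pi> x < inv \<pi> y \<and> inv \<pi> y < inv \<pi> z"
  then have "inv \<pi> x \<in> {1..n}" "inv \<pi> z \<in> {1..n}"
    using permutes_in_image[OF permutes_inv[OF \<pi>]] by blast+
  with * have "1 \<le> inv \<pi> x \<and> inv \<pi> x < inv \<pi> y \<and> inv \<pi> y < inv \<pi> z \<and> inv \<pi> z \<le> n \<and>
      \<pi> (inv \<pi> x) = x \<and> \<pi> (inv \<pi> y) = y \<and> \<pi> (inv \<pi> z) = z"
    by (simp add: permutes_inverses[OF \<pi>])
  then show "in_order n \<pi> x y z" unfolding in_order_def by blast
qed

text \<open>\<open>avoids_jki\<close> leaves \<open>k\<close> unbounded above. Its position precedes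
  that of \<open>i\<close>, hence is at most \<open>n\<close>, and \<open>inv \<pi>\<close> fixes
  everything outside \<open>{1..n}\<close>, so \<open>k \<le> n\<close>.\<close>

lemma avoids_jki_iff:
  assumes "\<pi> permutes {1..n}" "j \<in> {1..n}"
  shows "avoids_jki n \<pi> j \<longleftrightarrow> \<not> has_jki n (inv \<pi>) j"
proof -
  have "inv \<pi> k \<le> n" if "inv \<pi> k < inv \<pi> i" "i \<in> {1..n}" for i k
    using that permutes_in_image[OF permutes_inv[OF assms(1)], of i] by auto
  moreover have "k \<le> n" if "inv \<pi> k \<le> n" "j < k" for k
    using that permutes_not_in[OF permutes_inv[OF assms(1)], of k] by (cases "k \<le> n") auto
  ultimately show ?thesis
    using assms(2) unfolding avoids_jki_def has_jki_def in_order_iff[OF assms(1)] atLeastAtMost_iff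
    by (meson less_imp_le_nat order_trans)
qed

lemma avoids_kij_iff:
  assumes "\<pi> permutes {1..n}" "j \<in> {1..n}"
  shows "avoids_kij n \<pi> j \<longleftrightarrow> \<not> has_kij n (inv \<pi>) j"
proof -
  have "1 \<le> inv \<pi> i" if "inv \<pi> k < inv \<pi> i" for i k
    using that by simp
  moreover have "1 \<le> i" if "1 \<le> inv \<pi> i" for i
    using that permutes_not_in[OF permutes_inv[OF assms(1)], of i] by (cases i) auto
  ultimately show ?thesis
    using assms(2) unfolding avoids_kij_def has_kij_def in_order_iff[OF assms(1)] atLeastAtMost_iff
    by (meson less_imp_le_nat order_trans)
qed

lemma sortable_iff_avoids:
  assumes "coxeter_word n c" "2 \<le> n" "\<pi> permutes {1..n}"
  shows "sortable n c \<pi> \<longleftrightarrow>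
    (\<forall>j\<in>up_set n c. avoids_jki n \<pi> j) \<and> (\<forall>j\<in>down_set n c. avoids_kij n \<pi> j)"
proof -
  have "avoids_jki n \<pi> j \<longleftrightarrow> \<not> has_jki n (inv \<pi>) j" "avoids_kij n \<pi> j \<longleftrightarrow> \<not> has_kij n (inv \<pi>) j"
    if "j \<in> {2..n-1}" for j
    using that by (auto simp: avoids_jki_iff[OF assms(3)] avoids_kij_iff[OF assms(3)])
  then show ?thesis
    unfolding sortable_iff_aligned[OF assms] aligned_def up_set_def down_set_def by blast
qed

theorem theorem4p42:
  fixes n :: nat and c :: "nat list" and \<pi> :: "nat \<Rightarrow> nat"
  assumes "n \<ge> 3"
    and "coxeter_word n c"
    and "\<pi> permutes {1..n}"
  shows
    "(sortable n c \<pi> \<longleftrightarrow>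
        accepts (P_automaton n (up_set n c) (down_set n c)) (sorting_word n c \<pi>)) \<and>
     (sortable n c \<pi> \<longleftrightarrow>
        (\<exists>w. reduced_word_for n \<pi> w \<and>
             accepts (P_automaton n (up_set n c) (down_set n c)) w)) \<and>
     (sortable n c \<pi> \<longleftrightarrow>
        (\<forall>j\<in>{2..n-1}.
           (j \<in> up_set n c \<longrightarrow> (\<exists>w. reduced_word_for n \<pi> w \<and> accepts (U_automaton n j) w)) \<and>
           (j \<in> down_set n c \<longrightarrow> (\<exists>w. reduced_word_for n \<pi> w \<and> accepts (D_automaton j) w)))) \<and>
     (sortable n c \<pi> \<longleftrightarrow>
        (\<forall>j\<in>up_set n c. avoids_jki n \<pi> j) \<and> (\<forall>j\<in>down_set n c. avoids_kij n \<pi> j))"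
proof -
  let ?U = "up_set n c" and ?D = "down_set n c"
  let ?ii = "accepts (P_automaton n ?U ?D) (sorting_word n c \<pi>)"
  let ?iii = "\<exists>w. reduced_word_for n \<pi> w \<and> accepts (P_automaton n ?U ?D) w"
  let ?iv = "\<forall>j\<in>{2..n-1}.
    (j \<in> ?U \<longrightarrow> (\<exists>w. reduced_word_for n \<pi> w \<and> accepts (U_automaton n j) w)) \<and>
    (j \<in> ?D \<longrightarrow> (\<exists>w. reduced_word_for n \<pi> w \<and> accepts (D_automaton j) w))"
  let ?v = "(\<forall>j\<in>?U. avoids_jki n \<pi> j) \<and> (\<forall>j\<in>?D. avoids_kij n \<pi> j)"
  have c: "coxeter_word n c" "2 \<le> n" and \<pi>: "\<pi> permutes {1..n}" using assms by auto
  have range: "?U \<subseteq> {2..n-1}" "?D \<subseteq> {2..n-1}"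
    by (auto simp: up_set_def down_set_def)
  have "?U \<subseteq> {1..n}" "?D \<subseteq> {1..}" by (auto simp: up_set_def down_set_def)
  note accepts_P = accepts_P_iff[OF this]
  have red: "set w \<subseteq> {1..n-1}" "card (inversions n (word_perm w)) = length w" "word_perm w = \<pi>"
    if "reduced_word_for n \<pi> w" for w
    using that by (auto simp: reduced_word_for_iff[OF c \<pi>] word_for_def)
  \<comment> \<open>The implications run in a circle from (i) through (ii), (iii), (iv) and (v) back
    to (i).\<close>
  have "sortable n c \<pi> \<Longrightarrow> ?ii" by (rule sortable_accepts_sorting_word[OF c \<pi>])
  moreover have "?ii \<Longrightarrow> ?iii" using reduced_word_for_sorting_word[OF c \<pi>] by blast
  moreover have "?iii \<Longrightarrow> ?iv" unfolding accepts_P by blast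
  \<comment> \<open>The words in (iv) may differ from one \<open>j\<close> to the next; each
    automaton certifies its own pattern for the common permutation \<open>\<pi>\<close>.\<close>
  moreover have "?v" if iv: ?iv
  proof (intro conjI ballI)
    fix j assume j: "j \<in> ?U"
    with iv range obtain w where w: "reduced_word_for n \<pi> w" "accepts (U_automaton n j) w" by blast
    have "j \<le> n" using j by (auto simp: up_set_def)
    from avoids_jki_if_accepts_U[OF red(1,2)[OF w(1)] this w(2)] show "avoids_jki n \<pi> j"
      unfolding red(3)[OF w(1)] .
  next
    fix j assume j: "j \<in> ?D"
    with iv range obtain w where w: "reduced_word_for n \<pi> w" "accepts (D_automaton j) w" by blast
    have "1 \<le> j" "j < n" using j by (auto simp: down_set_def)
    from avoids_kij_if_accepts_D[OF red(1,2)[OF w(1)] this w(2)] show "avoids_kij n \<pi> j"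
      unfolding red(3)[OF w(1)] .
  qed
  moreover have "sortable n c \<pi> \<longleftrightarrow> ?v" by (rule sortable_iff_avoids[OF c \<pi>])
  ultimately show ?thesis by argo
qed

end
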